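(* Let $2\le n_1\le n_2\le n_3$ be integers, let $n=n_1+n_2+n_3$, and let $G=K_{n_1,n_2,n_3}$ be the complete tripartite graph with parts of sizes $n_1,n_2,n_3$. For integers $i\le j$ write $\zeta_i^j=\sum_{\gamma=i}^{j}\gamma$. Then the following hold. (i) If $3\zeta_{n-n_1+1}^{n}\ge \zeta_1^{n}\ge 3\zeta_1^{n_3}$ and $2\zeta_1^{n}\equiv 0 \pmod 6$, then $\theta(G)=0$. (ii) If $\zeta_1^{n}>3\zeta_{n-n_1+1}^{n}$ and $\zeta_1^{n}\ge 3\zeta_1^{n_3}$, then $$\theta(G)=\begin{cases}\left\lceil \dfrac{3\zeta_1^{n-n_1}-2\zeta_1^{n}}{2n_1}\right\rceil & \text{if } n-n_1\equiv 0 \text{ or } 3 \pmod 4,\\[2ex] \left\lceil \dfrac{3\zeta_1^{n-n_1}-2\zeta_1^{n}+1}{2n_1}\right\rceil & \text{if } n-n_1\equiv 1 \text{ or } 2 \pmod 4.\end{cases}$$ (iii) If $3\zeta_{n-n_1+1}^{n}<\zeta_1^{n}<3\zeta_1^{n_3}$, then $$\theta(G)\ge \left\lceil \frac{\zeta_1^{n_3}-\zeta_{n-n_1+1}^{n}}{n-n_3}\right\rceil .$$ (iv) If $3\zeta_{n-n_1+1}^{n}\ge \zeta_1^{n}\ge 3\zeta_1^{n_3}$ and $2\zeta_1^{n}\equiv 2 \pmod 6$, then $1\le \theta(G)\le n+1$. (v) If $\zeta_1^{n}\le 3\zeta_{n-n_1+1}^{n}$ and $\zeta_1^{n}<3\zeta_1^{n_3}$,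 then, with $H\cong K_{n_2,n_3}$ the complete bipartite graph with parts of sizes $n_2,n_3$, $$\theta(G)=\left\lceil \frac{\zeta_1^{n_3}-\zeta_{n-n_1+1}^{n}}{n_1}\right\rceil \quad\text{if } \frac{\zeta_1^{n_3}-\zeta_{n-n_1+1}^{n}}{n_1}\ge \theta(H),$$ $$\theta(G)\le \theta(H)+1 \quad\text{if } \frac{\zeta_1^{n_3}-\zeta_{n-n_1+1}^{n}}{n_1}< \theta(H).$$
   Context: All graphs are simple and finite; $N(u)$ denotes the set of vertices adjacent to $u$. Let $G$ be a graph on $n$ vertices and $S$ a set of $n$ (distinct) positive integers. $G$ is $S$-magic if there is a bijection $l:V(G)\to S$ and a constant $\mu'$ such that $\sum_{v\in N(u)}l(v)=\mu'$ for every vertex $u$ of $G$. Let $\eta(S)$ denote the largest element of $S$, and let $i(G)$ be the infimum of $\eta(S)$ over all sets $S$ of $n$ positive integers for which $G$ is $S$-magic. The distance magic index of $G$ is $\theta(G)=i(G)-n$ (it is infinite if $G$ is not $S$-magic for any $S$). *)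

theory Defs
  imports
    Graph_Theory.Graph_Theory
    "HOL-Number_Theory.Cong"
    "HOL-Library.Extended_Real"
begin

text \<open>
  Simple finite graphs are the symmetric digraphs of the locale \<^locale>\<open>graph\<close>. The notions
  below are defined for arbitrary \<^typ>\<open>('a, 'b) pre_digraph\<close> but are meant for such graphs.
\<close>

definition neighborhood :: "('a, 'b) pre_digraph \<Rightarrow> 'a \<Rightarrow> 'a set" where
  "neighborhood G u = {v. u \<rightarrow>\<^bsub>G\<^esub> v}"

text \<open>The tripartite analogue of \<^const>\<open>complete_bipartite_digraph\<close>.\<close>

definition complete_tripartite_digraph ::
    "nat \<Rightarrow> nat \<Rightarrow> nat \<Rightarrow> ('a, 'b) pre_digraph \<Rightarrow> bool" where
  "complete_tripartite_digraph k m n G \<longleftrightarrow> graph G \<and>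
     (\<exists>U V W. verts G = U \<union> V \<union> W \<and> U \<inter> V = {} \<and> U \<inter> W = {} \<and> V \<inter> W = {} \<and>
        card U = k \<and> card V = m \<and> card W = n \<and>
        arcs_ends G = U \<times> V \<union> V \<times> U \<union> U \<times> W \<union> W \<times> U \<union> V \<times> W \<union> W \<times> V)"

text \<open>\<open>G\<close> is \<open>S\<close>-magic; \<open>\<mu>\<close> is the magic constant.\<close>

definition set_magic :: "nat set \<Rightarrow> ('a, 'b) pre_digraph \<Rightarrow> bool" where
  "set_magic S G \<longleftrightarrow> (\<exists>l \<mu>. bij_betw l (verts G) S \<and>
     (\<forall>u \<in> verts G. (\<Sum>v \<in> neighborhood G u. l v) = \<mu>))"

text \<open>
  \<open>i(G)\<close>. The infimum is taken in \<^typ>\<open>ereal\<close>, so that it is \<open>\<infinity>\<close> when there is no admissible label set.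
\<close>

definition magic_inf :: "('a, 'b) pre_digraph \<Rightarrow> ereal" where
  "magic_inf G = (INF S \<in> {S. finite S \<and> card S = card (verts G) \<and> (\<forall>s \<in> S. 0 < s) \<and> set_magic S G}.
     ereal (real (Max S)))"

definition distance_magic_index :: "('a, 'b) pre_digraph \<Rightarrow> ereal" where
  "distance_magic_index G = magic_inf G - ereal (real (card (verts G)))"

definition zeta :: "nat \<Rightarrow> nat \<Rightarrow> nat" where
  "zeta i j = (\<Sum>\<gamma> = i..j. \<gamma>)"

end

theory Submission
  imports Defs
begin

text \<open>
  A label set is admissible for a complete tripartite graph exactly if it is the disjoint union of three sets
  of the sizes \<open>n1\<close>, \<open>n2\<close>, \<open>n3\<close> with equal sums \<open>s\<close>: the neighbourhoods of vertices in different parts are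
  unions of two parts (\<open>admissible_complete_tripartite_iff\<close>). If the largest label is \<open>n + t\<close>, then the smallest
  part has sum at most \<open>\<zeta>(n - n1 + 1, n) + t n1\<close>, the largest part has sum at least \<open>\<zeta>(1, n3)\<close>, and the two larger
  parts together have sum at least \<open>\<zeta>(1, n - n1)\<close>. These inequalities
  (\<open>admissible_tripartite_bounds\<close>), with parity and with \<open>3 s = \<zeta>(1, n)\<close> for \<open>t = 0\<close>, give all lower bounds.

  The upper bounds need labellings. If the top \<open>n1\<close> labels reach a third of \<open>\<zeta>(1, n)\<close> and the lowest \<open>n3\<close> do not
  exceed it, then \<open>{1..n}\<close> splits into parts whose sums differ by at most 1 (\<open>near_equal_tripartition\<close>): a
  partition that minimises the sum of the squares of the part sums cannot be improved by exchanging
  neighbouring numbers, and the few configurations that are stuck at larger differences are resolved by hand.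
  If \<open>3\<close> divides \<open>\<zeta>(1, n)\<close>, the sums are equal; if it leaves remainder 1, one
  sum is too large by 1, and raising one label per part by \<open>n\<close> or \<open>n + 1\<close> repairs this (\<open>shifted_labels\<close>).

  In the other two regimes the labels are written down up to a splitting of an interval with one gap into two
  parts of equal sums (\<open>bipartition_equal_sums\<close>). If the top \<open>n1\<close> labels are too small, they are spread upwards
  and the rest is split (\<open>equal_sum_triple_large_top\<close>). If the lowest \<open>n3\<close> labels are too large, they form the
  largest part, and a block of \<open>n1 + n2\<close> higher labels is split (\<open>equal_sum_triple_small_low\<close>). The size of
  this block is governed by the index \<open>h\<close> of \<open>K(n2, n3)\<close>, since the \<open>n2\<close> labels after \<open>n3\<close> have to be shifted
  by at least their deficit \<open>\<zeta>(1, n3) - \<zeta>(n3 + 1, n2 + n3) \<le> h n2\<close>. The hypotheses of the last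
  case force \<open>n2 < 2 n1\<close> and make the deficit of the top \<open>n1\<close> labels at most half of this, so that
  \<open>(\<zeta>(1, n3) - \<zeta>(n - n1 + 1, n)) / n1 \<ge> h\<close> is impossible, and its first alternative is vacuous.
\<close>

section \<open>Partitions with prescribed part sizes\<close>

lemma exchange:
  fixes P :: "nat set"
  assumes "finite P" "U \<subseteq> P" "finite V" "V \<inter> P = {}" "card U = card V"
  shows "card (P - U \<union> V) = card P" "\<Sum>(P - U \<union> V) + \<Sum>U = \<Sum>P + \<Sum>V"
proof -
  have fU: "finite U" using assms finite_subset by blast
  have cU: "card U \<le> card P" using assms card_mono by blast
  have d: "(P - U) \<inter> V = {}" using assms by blast
  have "card (P - U \<union> V) = card (P - U) + card V"
    using assms d by (intro card_Un_disjoint) auto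
  then show "card (P - U \<union> V) = card P"
    using assms fU cU by (simp add: card_Diff_subset)
  have "\<Sum>(P - U \<union> V) = \<Sum>(P - U) + \<Sum>V"
    using assms d by (intro sum.union_disjoint) auto
  moreover have "\<Sum>P = \<Sum>(P - U) + \<Sum>U"
    using assms by (simp add: sum.subset_diff)
  ultimately show "\<Sum>(P - U \<union> V) + \<Sum>U = \<Sum>P + \<Sum>V" by simp
qed

text \<open>
  \<open>P\<close> is a final segment of \<open>T\<close>. Among the subsets of \<open>T\<close> of a given size, the final segment has the
  largest sum; every other subset has an element whose successor in \<open>T\<close> lies outside of it.
\<close>

definition up_closed_in :: "nat set \<Rightarrow> nat set \<Rightarrow> bool" where
  "up_closed_in T P \<longleftrightarrow> (\<forall>x\<in>P. \<forall>y\<in>T. x < y \<longrightarrow> y \<in> P)"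

lemma up_closed_in_sum_max:
  assumes "finite T" "P \<subseteq> T" "X \<subseteq> T" "card X = card P" "up_closed_in T P"
  shows "\<Sum>X \<le> \<Sum>P"
proof -
  have fin: "finite P" "finite X" using assms finite_subset by blast+
  have c: "card (X - P) = card (P - X)"
    using fin assms(4) by (metis card_Diff_subset_Int Int_commute finite_Int)
  have le: "y \<le> x" if "x \<in> P - X" "y \<in> X - P" for x y
    using that assms unfolding up_closed_in_def by (metis DiffD1 DiffD2 in_mono not_less)
  have "\<Sum>(X - P) \<le> \<Sum>(P - X)"
  proof (cases "P - X = {}")
    case True
    with c fin have "X - P = {}" by (metis card_eq_0_iff card_0_eq finite_Diff)
    then show ?thesis by (metis sum.empty zero_le)
  next
    case False
    let ?m = "Min (P - X)"
    have fin': "finite (P - X)" "finite (X - P)" using fin by auto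
    have m: "?m \<in> P - X" using False fin' by (intro Min_in)
    have "\<Sum>(X - P) \<le> of_nat (card (X - P)) * ?m"
      by (rule sum_bounded_above) (use le[OF m] in auto)
    also have "\<dots> = of_nat (card (P - X)) * ?m" using c by simp
    also have "\<dots> \<le> \<Sum>(P - X)"
      by (rule sum_bounded_below) (use fin' in auto)
    finally show ?thesis .
  qed
  moreover have "\<Sum>X = \<Sum>(X - P) + \<Sum>(X \<inter> P)"
    using fin by (metis add.commute sum.Int_Diff)
  moreover have "\<Sum>P = \<Sum>(P - X) + \<Sum>(X \<inter> P)"
    using fin by (metis add.commute sum.Int_Diff Int_commute)
  ultimately show ?thesis by simp
qed

lemma ascent:
  assumes "P \<subseteq> T" "\<not> up_closed_in T P"
  obtains x y where "x \<in> P" "y \<in> T - P" "x < y" "\<And>z. z \<in> T \<Longrightarrow> x < z \<Longrightarrow> z < y \<Longrightarrow> False"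
proof -
  define ok where "ok d \<longleftrightarrow> (\<exists>x y. x \<in> P \<and> y \<in> T - P \<and> x < y \<and> d = y - x)" for d
  have "\<exists>d. ok d" using assms unfolding up_closed_in_def ok_def by blast
  then have l: "ok (LEAST d. ok d)" by (rule LeastI_ex)
  then obtain x y where xy: "x \<in> P" "y \<in> T - P" "x < y" "(LEAST d. ok d) = y - x"
    unfolding ok_def by blast
  have min: "y - x \<le> d" if "ok d" for d using that xy(4) by (metis Least_le)
  have False if z: "z \<in> T" "x < z" "z < y" for z
  proof (cases "z \<in> P")
    case True
    then have "ok (y - z)" using xy z unfolding ok_def by blast
    with min z show False by fastforce
  next
    case False
    then have "ok (z - x)" using xy z unfolding ok_def by blast
    with min z show False by fastforce
  qed
  with xy that show ?thesis by blast
qed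

lemma switch_between:
  fixes a b :: nat
  assumes "a < b" "S a" "\<not> S b"
  obtains i where "a \<le> i" "i < b" "S i" "\<not> S (i + 1)"
proof -
  have "\<exists>i. a \<le> i \<and> i < b \<and> S i \<and> \<not> S (i + 1)"
    using assms
  proof (induction "b - a" arbitrary: a)
    case 0 then show ?case by simp
  next
    case (Suc d)
    show ?case
    proof (cases "S (a + 1)")
      case False then show ?thesis using Suc by auto
    next
      case True
      then have "a + 1 < b" using Suc.prems by (metis Suc_eq_plus1 Suc_lessI)
      then show ?thesis using Suc.hyps(1)[of "a+1"] Suc.hyps(2) Suc.prems True
        by (metis Suc_diff_le Suc_eq_plus1 Suc_leD Suc_leI diff_Suc_Suc nat.inject)
    qed
  qed
  then show ?thesis using that by blast
qed

text \<open>
  A part may be empty; with \<open>C = {}\<close> this describes a partition of \<open>T\<close> into two sets.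
\<close>

definition tripartition :: "nat set \<Rightarrow> nat set \<Rightarrow> nat set \<Rightarrow> nat set \<Rightarrow> bool" where
  "tripartition T A B C \<longleftrightarrow> A \<union> B \<union> C = T \<and> A \<inter> B = {} \<and> A \<inter> C = {} \<and> B \<inter> C = {}"


text \<open>
  The partition of \<open>T\<close> into \<open>A\<close>, \<open>B\<close>, \<open>C\<close> can be replaced by one with the same part sizes whose parts have
  the sums \<open>a\<close>, \<open>b\<close>, \<open>c\<close>.
\<close>

definition resizable :: "nat set \<Rightarrow> nat set \<Rightarrow> nat set \<Rightarrow> nat set \<Rightarrow> nat \<Rightarrow> nat \<Rightarrow> nat \<Rightarrow> bool" where
  "resizable T A B C a b c \<longleftrightarrow> (\<exists>A' B' C'. tripartition T A' B' C' \<and>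
     card A' = card A \<and> card B' = card B \<and> card C' = card C \<and>
     \<Sum>A' = a \<and> \<Sum>B' = b \<and> \<Sum>C' = c)"

text \<open>
  The elements of \<open>U1 \<union> U2 \<union> U3\<close>, taken out of \<open>A\<close>, \<open>B\<close>, \<open>C\<close>, are redistributed as \<open>V1\<close>, \<open>V2\<close>, \<open>V3\<close>.
  The next lemmas are the instances that occur below.
\<close>

lemma resizableI:
  assumes T: "tripartition T A B C" "finite T"
    and U: "U1 \<subseteq> A" "U2 \<subseteq> B" "U3 \<subseteq> C"
    and V: "tripartition (U1 \<union> U2 \<union> U3) V1 V2 V3"
    and D: "V1 \<inter> A = {}" "V2 \<inter> B = {}" "V3 \<inter> C = {}"
    and c: "card U1 = card V1" "card U2 = card V2" "card U3 = card V3"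
    and s: "\<Sum>A + \<Sum>V1 = a + \<Sum>U1" "\<Sum>B + \<Sum>V2 = b + \<Sum>U2" "\<Sum>C + \<Sum>V3 = c + \<Sum>U3"
  shows "resizable T A B C a b c"
proof -
  have fin: "finite A" "finite B" "finite C"
    using T finite_subset[of _ T] unfolding tripartition_def by blast+
  have "finite (V1 \<union> V2 \<union> V3)" 
    using V U fin unfolding tripartition_def by (metis finite_Un finite_subset)
  then have fV: "finite V1" "finite V2" "finite V3" by auto
  have t: "A \<union> B \<union> C = T" "A \<inter> B = {}" "A \<inter> C = {}" "B \<inter> C = {}"
    using T(1) unfolding tripartition_def by blast+
  have v: "V1 \<union> V2 \<union> V3 = U1 \<union> U2 \<union> U3" "V1 \<inter> V2 = {}" "V1 \<inter> V3 = {}" "V2 \<inter> V3 = {}"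
    using V unfolding tripartition_def by blast+
  have w: "V1 \<subseteq> U1 \<union> U2 \<union> U3" "V2 \<subseteq> U1 \<union> U2 \<union> U3" "V3 \<subseteq> U1 \<union> U2 \<union> U3" using v(1) by blast+
  have "(A - U1 \<union> V1) \<union> (B - U2 \<union> V2) \<union> (C - U3 \<union> V3)
      = (A - U1) \<union> (B - U2) \<union> (C - U3) \<union> (V1 \<union> V2 \<union> V3)" by blast
  also have "\<dots> = T" unfolding v(1) using t(1) U by blast
  finally have "(A - U1 \<union> V1) \<union> (B - U2 \<union> V2) \<union> (C - U3 \<union> V3) = T" .
  moreover have "(A - U1 \<union> V1) \<inter> (B - U2 \<union> V2) = {}" using t(2-4) v(2) w(1,2) U by blast
  moreover have "(A - U1 \<union> V1) \<inter> (C - U3 \<union> V3) = {}" using t(2-4) v(3) w(1,3) U by blast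
  moreover have "(B - U2 \<union> V2) \<inter> (C - U3 \<union> V3) = {}" using t(2-4) v(4) w(2,3) U by blast
  ultimately have "tripartition T (A - U1 \<union> V1) (B - U2 \<union> V2) (C - U3 \<union> V3)"
    unfolding tripartition_def by blast
  moreover note A = exchange[OF fin(1) U(1) fV(1) D(1) c(1)]
    and B = exchange[OF fin(2) U(2) fV(2) D(2) c(2)]
    and C = exchange[OF fin(3) U(3) fV(3) D(3) c(3)]
  moreover have "\<Sum>(A - U1 \<union> V1) = a" "\<Sum>(B - U2 \<union> V2) = b" "\<Sum>(C - U3 \<union> V3) = c"
    using A(2) B(2) C(2) s by linarith+
  ultimately show ?thesis unfolding resizable_def by blast
qed

lemma resizable_swap12:
  assumes "tripartition T A B C" "finite T" "x \<in> A" "y \<in> B" "x < y" "y - x \<le> \<Sum>B"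
  shows "resizable T A B C (\<Sum>A + (y - x)) (\<Sum>B - (y - x)) (\<Sum>C)"
proof -
  have "x \<notin> B" "x \<notin> C" "y \<notin> A" "y \<notin> C" using assms(1,3,4) unfolding tripartition_def by blast+
  then show ?thesis using assms(3-)
    by (intro resizableI[OF assms(1,2), of "{x}" "{y}" "{}" "{y}" "{x}" "{}"])
       (auto simp: tripartition_def)
qed

lemma tripartition_perm:
  "tripartition T A B C \<Longrightarrow> tripartition T B A C"
  "tripartition T A B C \<Longrightarrow> tripartition T A C B"
  unfolding tripartition_def by blast+

lemma resizable_perm:
  "resizable T A B C a b c \<Longrightarrow> resizable T B A C b a c"
  "resizable T A B C a b c \<Longrightarrow> resizable T A C B a c b"
proof -
  assume "resizable T A B C a b c"
  then obtain A' B' C' where "tripartition T A' B' C'" "card A' = card A" "card B' = card B"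
    "card C' = card C" "\<Sum>A' = a" "\<Sum>B' = b" "\<Sum>C' = c" unfolding resizable_def by blast
  then show "resizable T B A C b a c" "resizable T A C B a c b"
    unfolding resizable_def using tripartition_perm by blast+
qed

lemma resizable_exchange:
  assumes T: "tripartition T A B C" "finite T"
    and in_A: "a1 \<in> A" "a2 \<in> A" "a1 \<noteq> a2" and in_C: "c1 \<in> C" "c2 \<in> C" "c1 \<noteq> c2"
    and sums: "\<Sum>A + c1 + c2 = a + a1 + a2" "\<Sum>B = b" "\<Sum>C + a1 + a2 = c + c1 + c2"
  shows "resizable T A B C a b c"
proof -
  have nA: "a1 \<notin> C" "a2 \<notin> C" and nC: "c1 \<notin> A" "c2 \<notin> A"
    using T(1) in_A in_C unfolding tripartition_def by blast+
  show ?thesis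
  proof (rule resizableI[OF T, of "{a1,a2}" "{}" "{c1,c2}" "{c1,c2}" "{}" "{a1,a2}"])
    show "tripartition ({a1, a2} \<union> {} \<union> {c1, c2}) {c1, c2} {} {a1, a2}"
      using nA in_C unfolding tripartition_def by blast
  qed (use in_A in_C nA nC sums in auto)
qed

lemma resizable_rotate:
  assumes T: "tripartition T A B C" "finite T"
    and in_A: "a1 \<in> A" "a2 \<in> A" "a1 \<noteq> a2" and in_B: "b1 \<in> B" "b2 \<in> B" "b1 \<noteq> b2"
    and in_C: "c1 \<in> C"
    and sums: "\<Sum>A + b1 + c1 = a + a1 + a2" "\<Sum>B + a1 + a2 = b + b1 + b2" "\<Sum>C + b2 = c + c1"
  shows "resizable T A B C a b c"
proof -
  have n: "a1 \<notin> C" "a2 \<notin> C" "c1 \<notin> A" "c1 \<notin> B" "a1 \<notin> B" "a2 \<notin> B" "b1 \<notin> A" "b2 \<notin> A" "b1 \<notin> C" "b2 \<notin> C"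
    using T(1) in_A in_B in_C unfolding tripartition_def by blast+
  then have d: "a1 \<noteq> b1" "a1 \<noteq> b2" "a2 \<noteq> b1" "a2 \<noteq> b2" "a1 \<noteq> c1" "a2 \<noteq> c1" "b1 \<noteq> c1" "b2 \<noteq> c1"
    using in_A in_B in_C by blast+
  show ?thesis
  proof (rule resizableI[OF T, of "{a1,a2}" "{b1,b2}" "{c1}" "{b1,c1}" "{a1,a2}" "{b2}"])
    show "tripartition ({a1, a2} \<union> {b1, b2} \<union> {c1}) {b1, c1} {a1, a2} {b2}"
      unfolding tripartition_def using d in_A(3) in_B(3) by simp blast
  qed (use in_A in_B in_C n d sums in \<open>simp_all add: eval_nat_numeral add.assoc\<close>)
qed

lemma resizable_two_swaps:
  assumes T: "tripartition T A B C" "finite T"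
    and a1: "a1 \<in> A" and in_B: "b1 \<in> B" "b2 \<in> B" "b1 \<noteq> b2" and c1: "c1 \<in> C"
    and sums: "\<Sum>A + b1 = a + a1" "\<Sum>B + a1 + c1 = b + b1 + b2" "\<Sum>C + b2 = c + c1"
  shows "resizable T A B C a b c"
proof -
  have n: "a1 \<notin> C" "c1 \<notin> A" "c1 \<notin> B" "a1 \<notin> B" "b1 \<notin> A" "b2 \<notin> A" "b1 \<notin> C" "b2 \<notin> C"
    using T(1) a1 in_B c1 unfolding tripartition_def by blast+
  then have d: "a1 \<noteq> b1" "a1 \<noteq> b2" "a1 \<noteq> c1" "b1 \<noteq> c1" "b2 \<noteq> c1"
    using a1 in_B c1 by blast+
  show ?thesis
  proof (rule resizableI[OF T, of "{a1}" "{b1,b2}" "{c1}" "{b1}" "{a1,c1}" "{b2}"])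
    show "tripartition ({a1} \<union> {b1, b2} \<union> {c1}) {b1} {a1, c1} {b2}"
      unfolding tripartition_def using d in_B(3) by simp blast
  qed (use a1 in_B c1 n d sums in \<open>simp_all add: eval_nat_numeral add.assoc\<close>)
qed

lemma resizable_reverse: "resizable T C B A c b a \<Longrightarrow> resizable T A B C a b c"
  using resizable_perm by blast

lemma tripartition_reverse: "tripartition T A B C \<Longrightarrow> tripartition T C B A"
  using tripartition_perm by blast

lemma ascent_interval:
  assumes "P \<subseteq> {1..n}" "\<not> up_closed_in {1..n} P"
  obtains x where "x \<in> P" "x + 1 \<in> {1..n} - P"
proof -
  from ascent[OF assms] obtain x y where xy: "x \<in> P" "y \<in> {1..n} - P" "x < y"
    "\<And>z. z \<in> {1..n} \<Longrightarrow> x < z \<Longrightarrow> z < y \<Longrightarrow> False" by blast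
  have "y = x + 1"
    using xy(2,3) xy(4)[of "x + 1"] by (cases "x + 1 < y") auto
  with xy that show ?thesis by blast
qed

text \<open>
  The situation in which exchanges of neighbouring numbers get stuck before the three sums are nearly equal:
  the sums are \<open>p\<close>, \<open>p + 1\<close>, \<open>p + 2\<close>, and no element of the part \<open>P\<close> with the smallest sum is followed by one of
  the part \<open>Q\<close> with the largest sum.
  Read \<open>{1..n}\<close> as a word over the letters \<open>P\<close>, \<open>R\<close>, \<open>Q\<close>. The factors \<open>PR\<close> and \<open>RQ\<close> occur, and exchanging
  the letters of a \<open>PR\<close> and of an \<open>RQ\<close> that is disjoint from it balances the three sums. So both occur
  exactly once, inside a factor \<open>PRQ\<close> at \<open>x\<close>, \<open>x + 1\<close>, \<open>x + 2\<close>. Reversing this factor to \<open>QRP\<close> overshoots by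
  exactly one unit, which is undone by reversing any disjoint factor \<open>QP\<close>, or a factor \<open>QR\<close> or \<open>RP\<close> together
  with the complementary half of \<open>QRP\<close>. Words without such a factor have a part that consists of a single
  element.
\<close>

lemma balance_arithmetic_triple:
  assumes T: "tripartition {1..n} P R Q"
    and card2: "2 \<le> card P" "2 \<le> card R" "2 \<le> card Q"
    and sums: "\<Sum>R = \<Sum>P + 1" "\<Sum>Q = \<Sum>P + 2"
    and up: "\<not> up_closed_in {1..n} P" "\<not> up_closed_in {1..n} (P \<union> R)"
    and noPQ: "\<And>x. x \<in> P \<Longrightarrow> x + 1 \<in> Q \<Longrightarrow> False"
  shows "resizable {1..n} P R Q (\<Sum>P + 1) (\<Sum>P + 1) (\<Sum>P + 1)"
proof (rule ccontr)
  let ?s = "\<Sum>P + 1"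
  assume no: "\<not> ?thesis"
  note fin = finite_atLeastAtMost[of 1 n]
  have un: "P \<union> R \<union> Q = {1..n}"
    using T unfolding tripartition_def by blast
  have mP: "z \<notin> R \<and> z \<notin> Q" if "z \<in> P" for z using T that unfolding tripartition_def by blast
  have mR: "z \<notin> P \<and> z \<notin> Q" if "z \<in> R" for z using T that unfolding tripartition_def by blast
  have mQ: "z \<notin> P \<and> z \<notin> R" if "z \<in> Q" for z using T that unfolding tripartition_def by blast
  have mem: "z \<in> P \<or> z \<in> R \<or> z \<in> Q \<longleftrightarrow> 1 \<le> z \<and> z \<le> n" for z
    using un by (metis UnE UnI1 UnI2 atLeastAtMost_iff)
  have cov: "z \<in> P \<or> z \<in> R \<or> z \<in> Q" if "1 \<le> z" "z \<le> n" for z using mem that by blast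
  have rng: "1 \<le> z \<and> z \<le> n" if "z \<in> P \<or> z \<in> R \<or> z \<in> Q" for z using mem that by blast
  obtain x0 where x0: "x0 \<in> P" "x0 + 1 \<in> {1..n} - P"
    using ascent_interval[OF _ up(1)] un by blast
  then have x0R: "x0 + 1 \<in> R" using noPQ[of x0] cov[of "x0 + 1"] by auto
  obtain y0 where y0: "y0 \<in> P \<union> R" "y0 + 1 \<in> {1..n} - (P \<union> R)"
    using ascent_interval[OF _ up(2)] un by blast
  then have y0Q: "y0 + 1 \<in> Q" "y0 \<in> R" using noPQ[of y0] cov[of "y0 + 1"] by auto
  \<comment> \<open>A factor \<open>PR\<close> and a factor \<open>RQ\<close> always share their \<open>R\<close>.\<close>
  have shared: "y = x + 1" if "x \<in> P" "x + 1 \<in> R" "y \<in> R" "y + 1 \<in> Q" for x y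
  proof (rule ccontr)
    assume ne: "y \<noteq> x + 1"
    moreover have "x \<noteq> y" "x \<noteq> y + 1" using that mP by blast+
    ultimately have "resizable {1..n} P R Q ?s ?s ?s"
        using that sums by (intro resizable_two_swaps[OF T fin, of x "x + 1" y "y + 1"]) auto
    with no show False by simp
  qed
  define x where "x = x0"
  have P0: "x \<in> P" and R0: "x + 1 \<in> R" using x0 x0R x_def by auto
  have "y0 = x + 1" using shared[OF P0 R0 y0Q(2,1)] .
  then have Q0: "x + 2 \<in> Q" using y0Q by simp
  have onlyPR: "z = x" if "z \<in> P" "z + 1 \<in> R" for z
    using shared[OF that R0] Q0 by simp
  have onlyRQ: "z = x + 1" if "z \<in> R" "z + 1 \<in> Q" for z
    using shared[OF P0 R0 that] .
  \<comment> \<open>The run of \<open>P\<close> that ends at \<open>x\<close> cannot be preceded by \<open>Q\<close> or \<open>R\<close> once it has length 2; the run of \<open>Q\<close>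
    that starts at \<open>x + 2\<close> is treated symmetrically.\<close>
  have L: "{1..x} \<subseteq> P" if x1: "x - 1 \<in> P"
  proof (rule ccontr)
    assume "\<not> {1..x} \<subseteq> P"
    then obtain a where "a \<in> {1..x}" and aP: "a \<notin> P" by blast
    then have a: "1 \<le> a" "a \<le> x" "a \<notin> P" by auto
    have "a \<noteq> x" "a \<noteq> x - 1" using a P0 x1 by auto
    with a have "a < x - 1" by linarith
    then obtain i where i: "a \<le> i" "i < x - 1" "i \<notin> P" "i + 1 \<in> P"
      using switch_between[of a "x - 1" "\<lambda>z. z \<notin> P"] a x1 by auto
    then have "i \<in> Q \<or> i \<in> R" using cov[of i] a rng[of x] P0 by linarith
    then show False
    proof
      assume "i \<in> Q"
      then have "resizable {1..n} P R Q ?s ?s ?s"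
        using i P0 Q0 sums by (intro resizable_exchange[OF T fin, of x "i + 1" "x + 2" i]) auto
      with no show False by simp
    next
      assume "i \<in> R"
      then have "resizable {1..n} P R Q ?s ?s ?s"
        using i P0 Q0 R0 sums by (intro resizable_rotate[OF T fin, of x "i + 1" i "x + 1" "x + 2"]) auto
      with no show False by simp
    qed
  qed
  have H: "{x+2..n} \<subseteq> Q" if x3: "x + 3 \<in> Q"
  proof (rule ccontr)
    assume "\<not> {x+2..n} \<subseteq> Q"
    then obtain a where "a \<in> {x+2..n}" and aQ: "a \<notin> Q" by blast
    then have a: "x + 2 \<le> a" "a \<le> n" "a \<notin> Q" by auto
    have "a \<noteq> x + 2" "a \<noteq> x + 3" using a Q0 x3 by auto
    with a have "x + 3 < a" by linarith
    then obtain i where i: "x + 3 \<le> i" "i < a" "i \<in> Q" "i + 1 \<notin> Q"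
      using switch_between[of "x + 3" a "\<lambda>z. z \<in> Q"] a x3 by auto
    then have "i + 1 \<in> P \<or> i + 1 \<in> R" using cov[of "i+1"] a by linarith
    then show False
    proof
      assume "i + 1 \<in> P"
      then have "resizable {1..n} P R Q ?s ?s ?s"
        using i P0 Q0 sums by (intro resizable_exchange[OF T fin, of x "i + 1" "x + 2" i]) auto
      with no show False by simp
    next
      assume "i + 1 \<in> R"
      then have "resizable {1..n} P R Q ?s ?s ?s"
        using i P0 Q0 R0 sums
        by (intro resizable_reverse[OF resizable_rotate[OF tripartition_reverse[OF T] fin, of "x + 2" i "i + 1" "x + 1" x]]) auto
      with no show False by simp
    qed
  qed
  have other: "\<exists>z\<in>X. z \<noteq> a" if "2 \<le> card X" for X :: "nat set" and a
  proof (rule ccontr)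
    assume "\<not> ?thesis"
    then have "X \<subseteq> {a}" by blast
    then have "card X \<le> 1" using card_mono[of "{a}" X] by simp
    with that show False by simp
  qed
  obtain p where p: "p \<in> P" "p \<noteq> x" using other[OF card2(1)] by blast
  obtain r where r: "r \<in> R" "r \<noteq> x + 1" using other[OF card2(2)] by blast
  obtain q where q: "q \<in> Q" "q \<noteq> x + 2" using other[OF card2(3)] by blast
  have lowP: "x - 1 \<in> P" if "p < x"
  proof (rule ccontr)
    assume n: "x - 1 \<notin> P"
    have "p \<noteq> x - 1" using p n by auto
    with that have "p < x - 1" by linarith
    then obtain i where i: "p \<le> i" "i < x - 1" "i \<in> P" "i + 1 \<notin> P"
      using switch_between[of p "x - 1" "\<lambda>z. z \<in> P"] p n by auto
    then have "i + 1 \<in> R \<or> i + 1 \<in> Q" using cov[of "i + 1"] rng[of x] P0 by linarith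
    then show False using i onlyPR[of i] noPQ[of i] by auto
  qed
  have highQ: "x + 3 \<in> Q" if "x + 3 \<le> q"
  proof (rule ccontr)
    assume n: "x + 3 \<notin> Q"
    have "q \<noteq> x + 3" using q n by auto
    with that have "x + 3 < q" by linarith
    then obtain i where i: "x + 3 \<le> i" "i < q" "i \<notin> Q" "i + 1 \<in> Q"
      using switch_between[of "x + 3" q "\<lambda>z. z \<notin> Q"] q n by auto
    then have "i \<in> R \<or> i \<in> P" using cov[of "i"] rng[of q] q by linarith
    then show False using i onlyRQ[of i] noPQ[of i] by auto
  qed
  have q_pos: "q < x \<or> x + 3 \<le> q"
  proof -
    have "q \<noteq> x" "q \<noteq> x + 1" "q \<noteq> x + 2" using q mP[OF P0] mR[OF R0] mQ[OF Q0] by auto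
    then show ?thesis by linarith
  qed
  have p_pos: "p < x \<or> x + 3 \<le> p"
  proof -
    have "p \<noteq> x" "p \<noteq> x + 1" "p \<noteq> x + 2" using p mP[OF P0] mR[OF R0] mQ[OF Q0] by auto
    then show ?thesis by linarith
  qed
  have r_pos: "r < x \<or> x + 3 \<le> r"
  proof -
    have "r \<noteq> x" "r \<noteq> x + 1" "r \<noteq> x + 2" using r mP[OF P0] mR[OF R0] mQ[OF Q0] by auto
    then show ?thesis by linarith
  qed
  \<comment> \<open>What remains is a word in which, apart from \<open>x\<close> and \<open>x + 2\<close>, every \<open>Q\<close> lies before and every \<open>P\<close> lies after
    the factor \<open>PRQ\<close>. A further \<open>R\<close> then produces a factor \<open>QR\<close> before or \<open>RP\<close> after it.\<close>
  have 1: False if "p < x"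
  proof -
    have sub: "{1..x} \<subseteq> P" using L lowP that by blast
    then have "\<not> q < x" using mQ[OF q(1)] rng[of q] q(1) subsetD[OF sub, of q] by auto
    then have "{x+2..n} \<subseteq> Q" using q_pos highQ H by blast
    then show False
      using subsetD[OF sub, of r] subsetD[of "{x+2..n}" Q r] r_pos mR[OF r(1)] rng[of r] r(1) by auto
  qed
  have 2: False if "x + 3 \<le> q"
  proof -
    have sub: "{x+2..n} \<subseteq> Q" using highQ H that by blast
    then have "\<not> x + 3 \<le> p" using mP[OF p(1)] rng[of p] p(1) subsetD[OF sub, of p] by auto
    then show False using p_pos 1 by blast
  qed
  have pq: "x + 3 \<le> p" "q < x" using 1 2 p_pos q_pos by blast+
  from r_pos show False
  proof
    assume rx: "r < x"
    have PL: "z \<notin> P" if "z < x" for z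
    proof
      assume z: "z \<in> P"
      show False
      proof (cases "x - 1 \<in> P")
        case True then show False
          using subsetD[OF L, of q] pq mQ[OF q(1)] rng[of q] q(1) by auto
      next
        case False
        have "z \<noteq> x - 1" using z False by auto
        with that have "z < x - 1" by linarith
        then obtain i where i: "z \<le> i" "i < x - 1" "i \<in> P" "i + 1 \<notin> P"
          using switch_between[of z "x - 1" "\<lambda>z. z \<in> P"] z False by auto
        then have "i + 1 \<in> R \<or> i + 1 \<in> Q" using cov[of "i + 1"] rng[of x] P0 by linarith
        then show False using i onlyPR[of i] noPQ[of i] by auto
      qed
    qed
    have "q < r"
    proof (rule ccontr)
      assume "\<not> q < r"
      then have "r < q" using q(1) mR[OF r(1)] by (cases "r = q") auto
      then obtain i where i: "r \<le> i" "i < q" "i \<notin> Q" "i + 1 \<in> Q"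
        using switch_between[of r q "\<lambda>z. z \<notin> Q"] q(1) mR[OF r(1)] by auto
      then have "i \<in> R" using cov[of i] rng[of r] rng[of q] r(1) q(1) PL[of i] pq by auto
      then show False using onlyRQ[of i] i pq by simp
    qed
    then obtain i where i: "q \<le> i" "i < r" "i \<in> Q" "i + 1 \<notin> Q"
      using switch_between[of q r "\<lambda>z. z \<in> Q"] q(1) mR[OF r(1)] by auto
    then have iR: "i + 1 \<in> R" using cov[of "i+1"] rng[of r] r(1) PL[of "i+1"] rx by auto
    have "resizable {1..n} P R Q ?s ?s ?s"
      using i iR rx P0 Q0 R0 sums
        by (intro resizable_reverse[OF resizable_rotate[OF tripartition_reverse[OF T] fin, of "x + 2" i "i + 1" "x + 1" x]]) auto
    with no show False by simp
  next
    assume rx: "x + 3 \<le> r"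
    have QH: "z \<notin> Q" if "x + 3 \<le> z" for z
    proof
      assume z: "z \<in> Q"
      show False
      proof (cases "x + 3 \<in> Q")
        case True then show False
          using subsetD[OF H, of p] pq mP[OF p(1)] rng[of p] p(1) by auto
      next
        case False
        have "z \<noteq> x + 3" using z False by auto
        with that have "x + 3 < z" by linarith
        then obtain i where i: "x + 3 \<le> i" "i < z" "i \<notin> Q" "i + 1 \<in> Q"
          using switch_between[of "x + 3" z "\<lambda>z. z \<notin> Q"] z False by auto
        then have "i \<in> R \<or> i \<in> P" using cov[of "i"] rng[of z] z by linarith
        then show False using i onlyRQ[of i] noPQ[of i] by auto
      qed
    qed
    have "r < p"
    proof (rule ccontr)
      assume "\<not> r < p"
      then have "p < r" using r(1) mP[OF p(1)] by (cases "r = p") auto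
      then obtain i where i: "p \<le> i" "i < r" "i \<in> P" "i + 1 \<notin> P"
        using switch_between[of p r "\<lambda>z. z \<in> P"] p(1) mR[OF r(1)] by auto
      then have "i + 1 \<in> R" using cov[of "i+1"] rng[of r] r(1) QH[of "i+1"] pq by auto
      then show False using onlyPR[of i] i pq by simp
    qed
    then obtain i where i: "r \<le> i" "i < p" "i \<notin> P" "i + 1 \<in> P"
      using switch_between[of r p "\<lambda>z. z \<notin> P"] p(1) mR[OF r(1)] by auto
    then have iR: "i \<in> R" using cov[of "i"] rng[of r] rng[of p] r(1) p(1) QH[of "i"] rx by auto
    have "resizable {1..n} P R Q ?s ?s ?s"
      using i iR rx P0 Q0 R0 sums by (intro resizable_rotate[OF T fin, of x "i + 1" i "x + 1" "x + 2"]) auto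
    with no show False by simp
  qed
qed

section \<open>Three parts with nearly equal sums\<close>

lemma squares_decrease:
  fixes a b :: nat
  assumes "a + 2 \<le> b"
  shows "(a + 1)\<^sup>2 + (b - 1)\<^sup>2 < a\<^sup>2 + b\<^sup>2"
proof -
  obtain d where "b = a + 2 + d" using assms nat_le_iff_add by blast
  then show ?thesis by (simp add: power2_eq_square algebra_simps)
qed

text \<open>
  A partition whose extreme sums differ by at least 2 does not minimise the sum of the squares of the part
  sums. The two hypotheses on final segments say that \<open>P\<close> does not consist of the largest and \<open>Q\<close> not of the
  smallest elements.
\<close>

lemma squares_step:
  assumes T: "tripartition {1..n} P R Q"
    and card2: "2 \<le> card P" "2 \<le> card R" "2 \<le> card Q"
    and order: "\<Sum>P \<le> \<Sum>R" "\<Sum>R \<le> \<Sum>Q" "\<Sum>P + 2 \<le> \<Sum>Q"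
    and up: "\<not> up_closed_in {1..n} P" "\<not> up_closed_in {1..n} (P \<union> R)"
  obtains p r q where "resizable {1..n} P R Q p r q"
    "p\<^sup>2 + r\<^sup>2 + q\<^sup>2 < (\<Sum>P)\<^sup>2 + (\<Sum>R)\<^sup>2 + (\<Sum>Q)\<^sup>2"
proof -
  note goal = that
  note fin = finite_atLeastAtMost[of 1 n]
  have un: "P \<union> R \<union> Q = {1..n}"
    using T unfolding tripartition_def by blast
  have T': "tripartition {1..n} P Q R" "tripartition {1..n} R Q P"
    using T tripartition_perm by blast+
  have swapPR: thesis if "x \<in> P" "x + 1 \<in> R" "\<Sum>P + 2 \<le> \<Sum>R" for x
    using that(3) resizable_swap12[OF T fin that(1,2)] squares_decrease[OF that(3)]
    by (intro goal[of "\<Sum>P + 1" "\<Sum>R - 1" "\<Sum>Q"]) auto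
  have swapPQ: thesis if "x \<in> P" "x + 1 \<in> Q" for x
    using order(3) resizable_perm(2)[OF resizable_swap12[OF T'(1) fin that(1,2)]] squares_decrease[OF order(3)]
    by (intro goal[of "\<Sum>P + 1" "\<Sum>R" "\<Sum>Q - 1"]) auto
  have swapRQ: thesis if "x \<in> R" "x + 1 \<in> Q" "\<Sum>R + 2 \<le> \<Sum>Q" for x
    using that(3) resizable_perm(1)[OF resizable_perm(2)[OF resizable_swap12[OF T'(2) fin that(1,2)]]] squares_decrease[OF that(3)]
    by (intro goal[of "\<Sum>P" "\<Sum>R + 1" "\<Sum>Q - 1"]) auto
  consider "\<Sum>P + 2 \<le> \<Sum>R" | "\<Sum>R + 2 \<le> \<Sum>Q" | "\<exists>x\<in>P. x + 1 \<in> Q"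
    | "\<Sum>R = \<Sum>P + 1" "\<Sum>Q = \<Sum>P + 2" "\<forall>x\<in>P. x + 1 \<notin> Q"
  proof -
    have "\<not> \<Sum>P + 2 \<le> \<Sum>R \<Longrightarrow> \<not> \<Sum>R + 2 \<le> \<Sum>Q \<Longrightarrow> \<Sum>R = \<Sum>P + 1 \<and> \<Sum>Q = \<Sum>P + 2"
      using order by linarith
    then show ?thesis using that by blast
  qed
  then show thesis
  proof cases
    case 1
    obtain x where x: "x \<in> P" "x + 1 \<in> {1..n} - P"
      using ascent_interval[OF _ up(1)] un by blast
    then have "x + 1 \<in> R \<or> x + 1 \<in> Q" using un by blast
    then show thesis using swapPR[OF x(1) _ 1] swapPQ[OF x(1)] by blast
  next
    case 2
    obtain x where x: "x \<in> P \<union> R" "x + 1 \<in> {1..n} - (P \<union> R)"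
      using ascent_interval[OF _ up(2)] un by blast
    then have "x + 1 \<in> Q" using un by blast
    then show thesis using x(1) swapRQ[OF _ _ 2, of x] swapPQ[of x] by blast
  next
    case 3
    then show thesis using swapPQ by blast
  next
    case 4
    have "resizable {1..n} P R Q (\<Sum>P + 1) (\<Sum>P + 1) (\<Sum>P + 1)"
      using balance_arithmetic_triple[OF T card2 4(1,2) up] 4(3) by blast
    then show thesis
      by (rule goal) (use 4 in \<open>simp add: power2_eq_square algebra_simps\<close>)
  qed
qed

lemma sum_up_closed_interval:
  assumes "P \<subseteq> {1..n}" "up_closed_in {1..n} P"
  shows "\<Sum>{n - card P + 1..n} \<le> \<Sum>P"
proof -
  have "card P \<le> n" using card_mono[OF _ assms(1)] by simp
  then show ?thesis
    by (intro up_closed_in_sum_max[OF _ assms(1) _ _ assms(2)]) auto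
qed

lemma local_min_near_equal:
  assumes T: "tripartition {1..n} P R Q"
    and card2: "2 \<le> card P" "2 \<le> card R" "2 \<le> card Q"
    and order: "\<Sum>P \<le> \<Sum>R" "\<Sum>R \<le> \<Sum>Q"
    and a: "a \<le> card P" "\<Sum>{1..n} \<le> 3 * \<Sum>{n - a + 1..n}"
    and c: "card Q \<le> c" "3 * \<Sum>{1..c} \<le> \<Sum>{1..n}"
    and min: "\<And>p r q. resizable {1..n} P R Q p r q \<Longrightarrow>
                (\<Sum>P)\<^sup>2 + (\<Sum>R)\<^sup>2 + (\<Sum>Q)\<^sup>2 \<le> p\<^sup>2 + r\<^sup>2 + q\<^sup>2"
  shows "\<Sum>Q \<le> \<Sum>P + 1"
proof (rule ccontr)
  assume "\<not> ?thesis"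
  then have gap: "\<Sum>P + 2 \<le> \<Sum>Q" by simp
  have un: "P \<union> R \<union> Q = {1..n}" and dj: "(P \<union> R) \<inter> Q = {}" "P \<inter> R = {}"
    using T unfolding tripartition_def by blast+
  have fin: "finite P" "finite R" "finite Q"
    using un by (metis finite_Un finite_atLeastAtMost)+
  have sPR: "\<Sum>(P \<union> R) = \<Sum>P + \<Sum>R"
    using fin dj by (intro sum.union_disjoint) auto
  have tot: "\<Sum>{1..n} = \<Sum>(P \<union> R) + \<Sum>Q"
    unfolding un[symmetric] using fin dj by (intro sum.union_disjoint) auto
  have cn: "n = card (P \<union> R) + card Q"
    using un fin dj card_Un_disjoint[of "P \<union> R" Q] by simp
  have "\<not> up_closed_in {1..n} P"
  proof
    assume "up_closed_in {1..n} P"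
    then have "\<Sum>{n - card P + 1..n} \<le> \<Sum>P" using sum_up_closed_interval un by blast
    moreover have "\<Sum>{n - a + 1..n} \<le> \<Sum>{n - card P + 1..n}"
      using a(1) by (intro sum_mono2) auto
    ultimately show False using a(2) tot sPR order gap by linarith
  qed
  moreover have "\<not> up_closed_in {1..n} (P \<union> R)"
  proof
    assume "up_closed_in {1..n} (P \<union> R)"
    then have "\<Sum>{n - card (P \<union> R) + 1..n} \<le> \<Sum>(P \<union> R)" using sum_up_closed_interval un by blast
    moreover have "n - card (P \<union> R) = card Q" using cn by simp
    moreover have "\<Sum>{1..n} = \<Sum>{1..card Q} + \<Sum>{card Q + 1..n}"
      using cn by (subst sum.union_disjoint[symmetric]) (auto intro!: sum.cong)
    moreover have "\<Sum>{1..card Q} \<le> \<Sum>{1..c}" using c(1) by (intro sum_mono2) auto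
    ultimately show False using c(2) tot sPR order gap by simp
  qed
  ultimately show False
    using squares_step[OF T card2 order gap] min by (metis not_le)
qed

text \<open>
  For part sizes of at least 2 the two obviously necessary conditions suffice: the \<open>a\<close> largest numbers
  reach a third of the total, and the \<open>c\<close> smallest ones do not exceed it. A partition that minimises the sum
  of squares does the job.
\<close>

theorem near_equal_tripartition:
  assumes "2 \<le> a" "a \<le> b" "b \<le> c" "n = a + b + c"
    and top: "\<Sum>{1..n} \<le> 3 * \<Sum>{n - a + 1..n}"
    and bot: "3 * \<Sum>{1..c} \<le> \<Sum>{1..n}"
  obtains A B C where "tripartition {1..n} A B C" "card A = a" "card B = b" "card C = c"
    "\<forall>X\<in>{A,B,C}. \<forall>Y\<in>{A,B,C}. \<Sum>X \<le> \<Sum>Y + 1"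
proof -
  define ok where "ok A B C \<longleftrightarrow> tripartition {1..n} A B C \<and> card A = a \<and> card B = b \<and> card C = c" for A B C
  define val where "val k \<longleftrightarrow> (\<exists>A B C. ok A B C \<and> k = (\<Sum>A)\<^sup>2 + (\<Sum>B)\<^sup>2 + (\<Sum>C)\<^sup>2)" for k :: nat
  have "ok {1..a} {a+1..a+b} {a+b+1..n}"
    unfolding ok_def tripartition_def using assms by auto
  then have "\<exists>k. val k" unfolding val_def by blast
  then have "val (LEAST k. val k)" by (rule LeastI_ex)
  then obtain A B C where ABC: "ok A B C" "(LEAST k. val k) = (\<Sum>A)\<^sup>2 + (\<Sum>B)\<^sup>2 + (\<Sum>C)\<^sup>2"
    unfolding val_def by blast
  have min: "(\<Sum>A)\<^sup>2 + (\<Sum>B)\<^sup>2 + (\<Sum>C)\<^sup>2 \<le> p\<^sup>2 + r\<^sup>2 + q\<^sup>2" if "resizable {1..n} A B C p r q" for p r q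
  proof -
    have "val (p\<^sup>2 + r\<^sup>2 + q\<^sup>2)"
      using that ABC(1) unfolding val_def ok_def resizable_def by metis
    then show ?thesis using ABC(2) Least_le by metis
  qed
  have T: "tripartition {1..n} A B C" and card: "card A = a" "card B = b" "card C = c"
    using ABC(1) unfolding ok_def by auto
  have key: "\<Sum>Q \<le> \<Sum>P + 1"
    if "tripartition {1..n} P R Q" "card P \<in> {a,b,c} \<and> card R \<in> {a,b,c} \<and> card Q \<in> {a,b,c}" "\<Sum>P \<le> \<Sum>R" "\<Sum>R \<le> \<Sum>Q"
      "(\<Sum>P)\<^sup>2 + (\<Sum>R)\<^sup>2 + (\<Sum>Q)\<^sup>2 = (\<Sum>A)\<^sup>2 + (\<Sum>B)\<^sup>2 + (\<Sum>C)\<^sup>2"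
      and perm: "\<And>p r q. resizable {1..n} P R Q p r q \<Longrightarrow> 
         (\<Sum>A)\<^sup>2 + (\<Sum>B)\<^sup>2 + (\<Sum>C)\<^sup>2 \<le> p\<^sup>2 + r\<^sup>2 + q\<^sup>2" for P R Q
  proof (rule local_min_near_equal[OF that(1) _ _ _ that(3,4) _ top _ bot])
    show "2 \<le> card P" "2 \<le> card R" "2 \<le> card Q" "a \<le> card P" "card Q \<le> c"
      using that(2) assms(1-3) by auto
  qed (use that(5) perm in simp)
  note r = resizable_perm
  have min': "resizable {1..n} A C B p r q \<Longrightarrow> (\<Sum>A)\<^sup>2 + (\<Sum>B)\<^sup>2 + (\<Sum>C)\<^sup>2 \<le> p\<^sup>2 + r\<^sup>2 + q\<^sup>2"
    "resizable {1..n} B A C p r q \<Longrightarrow> (\<Sum>A)\<^sup>2 + (\<Sum>B)\<^sup>2 + (\<Sum>C)\<^sup>2 \<le> p\<^sup>2 + r\<^sup>2 + q\<^sup>2"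
    "resizable {1..n} B C A p r q \<Longrightarrow> (\<Sum>A)\<^sup>2 + (\<Sum>B)\<^sup>2 + (\<Sum>C)\<^sup>2 \<le> p\<^sup>2 + r\<^sup>2 + q\<^sup>2"
    "resizable {1..n} C A B p r q \<Longrightarrow> (\<Sum>A)\<^sup>2 + (\<Sum>B)\<^sup>2 + (\<Sum>C)\<^sup>2 \<le> p\<^sup>2 + r\<^sup>2 + q\<^sup>2"
    "resizable {1..n} C B A p r q \<Longrightarrow> (\<Sum>A)\<^sup>2 + (\<Sum>B)\<^sup>2 + (\<Sum>C)\<^sup>2 \<le> p\<^sup>2 + r\<^sup>2 + q\<^sup>2" for p r q
  proof -
    show "(\<Sum>A)\<^sup>2 + (\<Sum>B)\<^sup>2 + (\<Sum>C)\<^sup>2 \<le> p\<^sup>2 + r\<^sup>2 + q\<^sup>2" if "resizable {1..n} A C B p r q"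
      using min[OF r(2)[OF that]] by simp
    show "(\<Sum>A)\<^sup>2 + (\<Sum>B)\<^sup>2 + (\<Sum>C)\<^sup>2 \<le> p\<^sup>2 + r\<^sup>2 + q\<^sup>2" if "resizable {1..n} B A C p r q"
      using min[OF r(1)[OF that]] by simp
    show "(\<Sum>A)\<^sup>2 + (\<Sum>B)\<^sup>2 + (\<Sum>C)\<^sup>2 \<le> p\<^sup>2 + r\<^sup>2 + q\<^sup>2" if "resizable {1..n} B C A p r q"
      using min[OF r(1)[OF r(2)[OF that]]] by simp
    show "(\<Sum>A)\<^sup>2 + (\<Sum>B)\<^sup>2 + (\<Sum>C)\<^sup>2 \<le> p\<^sup>2 + r\<^sup>2 + q\<^sup>2" if "resizable {1..n} C A B p r q"
      using min[OF r(2)[OF r(1)[OF that]]] by simp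
    show "(\<Sum>A)\<^sup>2 + (\<Sum>B)\<^sup>2 + (\<Sum>C)\<^sup>2 \<le> p\<^sup>2 + r\<^sup>2 + q\<^sup>2" if "resizable {1..n} C B A p r q"
      using min[OF resizable_reverse[OF that]] by simp
  qed
  have T': "tripartition {1..n} A C B" "tripartition {1..n} B A C" "tripartition {1..n} B C A"
    "tripartition {1..n} C A B" "tripartition {1..n} C B A"
    using T unfolding tripartition_def by blast+
  have "\<Sum>A \<le> \<Sum>B \<Longrightarrow> \<Sum>B \<le> \<Sum>C \<Longrightarrow> \<Sum>C \<le> \<Sum>A + 1"
    by (rule key[OF T]) (use min card in auto)
  moreover have "\<Sum>A \<le> \<Sum>C \<Longrightarrow> \<Sum>C \<le> \<Sum>B \<Longrightarrow> \<Sum>B \<le> \<Sum>A + 1"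
    by (rule key[OF T'(1)]) (use min' card in auto)
  moreover have "\<Sum>B \<le> \<Sum>A \<Longrightarrow> \<Sum>A \<le> \<Sum>C \<Longrightarrow> \<Sum>C \<le> \<Sum>B + 1"
    by (rule key[OF T'(2)]) (use min' card in auto)
  moreover have "\<Sum>B \<le> \<Sum>C \<Longrightarrow> \<Sum>C \<le> \<Sum>A \<Longrightarrow> \<Sum>A \<le> \<Sum>B + 1"
    by (rule key[OF T'(3)]) (use min' card in auto)
  moreover have "\<Sum>C \<le> \<Sum>A \<Longrightarrow> \<Sum>A \<le> \<Sum>B \<Longrightarrow> \<Sum>B \<le> \<Sum>C + 1"
    by (rule key[OF T'(4)]) (use min' card in auto)
  moreover have "\<Sum>C \<le> \<Sum>B \<Longrightarrow> \<Sum>B \<le> \<Sum>A \<Longrightarrow> \<Sum>A \<le> \<Sum>C + 1"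
    by (rule key[OF T'(5)]) (use min' card in auto)
  ultimately have "\<Sum>A \<le> \<Sum>B + 1" "\<Sum>A \<le> \<Sum>C + 1" "\<Sum>B \<le> \<Sum>A + 1" "\<Sum>B \<le> \<Sum>C + 1"
    "\<Sum>C \<le> \<Sum>A + 1" "\<Sum>C \<le> \<Sum>B + 1"
    by linarith+
  then show thesis using that[OF T card] by auto
qed

section \<open>Two parts with equal sums\<close>

text \<open>
  The analogue for two parts of an interval with one element removed. A neighbouring pair that is
  separated by the gap \<open>r\<close> changes each sum by 2, which is too much when the sums differ by 2 only; then a
  second exchange in the opposite direction corrects the error. It is available unless one part
  lies below the gap and the other one above, or becomes so after the exchange across the gap. The last
  hypothesis excludes this.
\<close>

lemma bipartition_step:
  assumes r: "r \<in> {a..b}" and T: "tripartition ({a..b} - {r}) P Q {}"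
    and card2: "2 \<le> card P" "2 \<le> card Q"
    and even: "even (\<Sum>P + \<Sum>Q)" and less: "\<Sum>P < \<Sum>Q"
    and up: "\<not> up_closed_in ({a..b} - {r}) P"
    and blocks: "\<Sum>{r<..b} = \<Sum>{a..<r} + 2 \<Longrightarrow> card {r<..b} \<noteq> card P \<and> card {r<..b} \<noteq> card Q"
  obtains p q where "resizable ({a..b} - {r}) P Q {} p q 0" "(p - q) + (q - p) < \<Sum>Q - \<Sum>P"
proof -
  note goal = that
  let ?T = "{a..b} - {r}"
  have fin: "finite ?T" by simp
  have mem: "z \<in> P \<or> z \<in> Q \<longleftrightarrow> a \<le> z \<and> z \<le> b \<and> z \<noteq> r" for z
    using T unfolding tripartition_def by (metis DiffE DiffI Un_iff Un_empty_right atLeastAtMost_iff singleton_iff)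
  have dj: "P \<inter> Q = {}" and un: "P \<union> Q = ?T" using T unfolding tripartition_def by auto
  have mP: "z \<notin> Q" if "z \<in> P" for z using dj that by blast
  have mQ: "z \<notin> P" if "z \<in> Q" for z using dj that by blast
  have ge2: "\<Sum>P + 2 \<le> \<Sum>Q" using even less by presburger
  show thesis
  proof (rule ccontr)
    assume not_thesis: "\<not> thesis"
    have thesis
    proof (cases "\<exists>x\<in>P. x + 1 \<in> Q")
      case True
      then obtain x where x: "x \<in> P" "x + 1 \<in> Q" by blast
      show thesis
        using resizable_swap12[OF T fin x] ge2 by (intro goal[of "\<Sum>P + 1" "\<Sum>Q - 1"]) auto
    next
      case no: False
      obtain x y where xy: "x \<in> P" "y \<in> ?T - P" "x < y" "\<And>z. z \<in> ?T \<Longrightarrow> x < z \<Longrightarrow> z < y \<Longrightarrow> False"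
        using ascent[OF _ up] un by blast
      have yQ: "y \<in> Q" using xy(2) un by blast
      have rx: "r = x + 1"
      proof (rule ccontr)
        assume "r \<noteq> x + 1"
        moreover have "y \<noteq> x + 1" using no xy(1) yQ by blast
        ultimately show False using xy(4)[of "x + 1"] xy(2,3) mem[of x] xy(1) by auto
      qed
      have y: "y = x + 2"
        using xy(4)[of "x + 2"] xy(2,3) mem[of x] xy(1) rx by (cases "x + 2 < y") auto
      show thesis
      proof (cases "\<Sum>Q = \<Sum>P + 2")
        case False
        then have "\<Sum>P + 4 \<le> \<Sum>Q" using even less by presburger
        then show thesis
          using resizable_swap12[OF T fin xy(1) yQ xy(3)] y
          by (intro goal[of "\<Sum>P + 2" "\<Sum>Q - 2"]) auto
      next
        case d2: True
        \<comment> \<open>Exchanging \<open>x\<close> with \<open>y\<close> and a disjoint descent \<open>u \<in> Q\<close>, \<open>u + 1 \<in> P\<close> would balance the sums.\<close>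
        have desc: False if u: "u \<in> Q" "u + 1 \<in> P" "u + 1 \<noteq> x" "u \<noteq> y" for u
        proof -
          have "resizable ?T P {} Q (\<Sum>P + 1) 0 (\<Sum>P + 1)"
            using u xy(1) yQ y d2
            by (intro resizable_exchange[OF tripartition_perm(2)[OF T] fin, of x "u + 1" y u]) auto
          then have "resizable ?T P Q {} (\<Sum>P + 1) (\<Sum>P + 1) 0" by (rule resizable_perm(2))
          then have thesis by (rule goal) (use d2 in simp)
          with not_thesis show False by simp
        qed
        have asc: False if "i \<in> P" "i + 1 \<in> Q" for i using no that by blast
        \<comment> \<open>Hence if both parts occur below the gap, then \<open>P\<close> has only the element \<open>x\<close> there, and if both occur
          above it, then \<open>Q\<close> has only the element \<open>y\<close> there.\<close>
        have low: "v = x" if u: "u \<in> Q" "u < r" and v: "v \<in> P" "v < r" for u v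
        proof (rule ccontr)
          assume "v \<noteq> x"
          moreover have "u \<noteq> x" using u mP[OF xy(1)] by blast
          ultimately have lt: "u < x" "v < x" using u v rx by linarith+
          show False
          proof (cases "u < v")
            case True
            then obtain i where i: "u \<le> i" "i < v" "i \<in> Q" "i + 1 \<notin> Q"
              using switch_between[of u v "\<lambda>z. z \<in> Q"] u(1) mP[OF v(1)] by auto
            then have "i + 1 \<in> P" using mem[of "i + 1"] mem[of i] mem[of v] v lt rx by auto
            then show False using desc[of i] i lt y by simp
          next
            case False
            then have "v < u" using u(1) mP[OF v(1)] by (cases "u = v") auto
            then obtain i where i: "v \<le> i" "i < u" "i \<in> P" "i + 1 \<notin> P"
              using switch_between[of v u "\<lambda>z. z \<in> P"] v(1) mQ[OF u(1)] by auto
            then have "i + 1 \<in> Q" using mem[of "i + 1"] mem[of i] mem[of u] u lt rx by auto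
            then show False using asc i by blast
          qed
        qed
        have high: "u = y" if u: "u \<in> Q" "r < u" and v: "v \<in> P" "r < v" for u v
        proof (rule ccontr)
          assume "u \<noteq> y"
          moreover have "v \<noteq> y" using v mQ[OF yQ] by blast
          ultimately have lt: "y < u" "y < v" using u v rx y by linarith+
          show False
          proof (cases "u < v")
            case True
            then obtain i where i: "u \<le> i" "i < v" "i \<in> Q" "i + 1 \<notin> Q"
              using switch_between[of u v "\<lambda>z. z \<in> Q"] u(1) mP[OF v(1)] by auto
            then have "i + 1 \<in> P" using mem[of "i + 1"] mem[of i] mem[of v] v lt rx y by auto
            then show False using desc[of i] i lt y by simp
          next
            case False
            then have "v < u" using u(1) mP[OF v(1)] by (cases "u = v") auto
            then obtain i where i: "v \<le> i" "i < u" "i \<in> P" "i + 1 \<notin> P"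
              using switch_between[of v u "\<lambda>z. z \<in> P"] v(1) mQ[OF u(1)] by auto
            then have "i + 1 \<in> Q" using mem[of "i + 1"] mem[of i] mem[of u] u lt rx y by auto
            then show False using asc i by blast
          qed
        qed
        have rng: "z \<in> {a..<r} \<longleftrightarrow> (z \<in> P \<or> z \<in> Q) \<and> z < r" "z \<in> {r<..b} \<longleftrightarrow> (z \<in> P \<or> z \<in> Q) \<and> r < z" for z
          using mem[of z] r by auto
        have finPQ: "finite P" "finite Q" using un by (metis fin finite_Un)+
        have nr: "z \<noteq> r" if "z \<in> P \<or> z \<in> Q" for z using mem that by blast
        have False
        proof (cases "\<exists>u\<in>Q. u < r")
          case True
          then obtain u where u: "u \<in> Q" "u < r" by blast
          have "\<not> P \<subseteq> {x}" using card_mono[of "{x}" P] card2(1) by auto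
          then obtain v where "v \<in> P" "v \<noteq> x" by blast
          moreover have "v \<noteq> r" "\<not> v < r" using calculation low[OF u, of v] nr[of v] by blast+
          ultimately have v: "v \<in> P" "r < v" by auto
          have hP: "{r<..b} = P - {x} \<union> {y}"
          proof (rule set_eqI)
            fix z
            show "z \<in> {r<..b} \<longleftrightarrow> z \<in> P - {x} \<union> {y}"
              using rng(2)[of z] high[of z v] low[OF u, of z] nr[of z] xy(1) yQ rx y v linorder_less_linear[of z r]
              by (metis DiffE DiffI UnE UnI1 UnI2 less_add_one add_2_eq_Suc' Suc_eq_plus1 lessI not_less_iff_gr_or_eq singleton_iff)
          qed
          have lQ: "{a..<r} = Q - {y} \<union> {x}"
          proof (rule set_eqI)
            fix z
            show "z \<in> {a..<r} \<longleftrightarrow> z \<in> Q - {y} \<union> {x}"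
              using rng(1)[of z] high[of z v] low[OF u, of z] nr[of z] xy(1) yQ rx y v linorder_less_linear[of z r]
              by (metis DiffE DiffI UnE UnI1 UnI2 less_add_one add_2_eq_Suc' Suc_eq_plus1 lessI not_less_iff_gr_or_eq singleton_iff)
          qed
          have "card {r<..b} = card P" "\<Sum>{r<..b} + x = \<Sum>P + y"
            unfolding hP using exchange[of P "{x}" "{y}"] finPQ xy(1) mQ[OF yQ] by simp_all
          moreover have "\<Sum>{a..<r} + y = \<Sum>Q + x"
            unfolding lQ using exchange[of Q "{y}" "{x}"] finPQ yQ mP[OF xy(1)] by simp
          ultimately show False using blocks d2 y by simp
        next
          case noQ: False
          show False
          proof (cases "\<exists>v\<in>P. r < v")
            case True
            then obtain v where v: "v \<in> P" "r < v" by blast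
            then have "Q \<subseteq> {y}" using high noQ nr by (metis linorder_neqE_nat singleton_iff subsetI)
            then show False using card_mono[of "{y}" Q] card2(2) by simp
          next
            case False
            have "{a..<r} = P"
              by (rule set_eqI) (metis False noQ nr rng(1) linorder_less_linear)
            moreover have "{r<..b} = Q"
              by (rule set_eqI) (metis False noQ nr rng(2) linorder_less_linear)
            ultimately show False using blocks d2 by simp
          qed
        qed
        then show thesis ..
      qed
    qed
    with not_thesis show False by simp
  qed
qed

text \<open>
  An interval with one gap splits into two parts of prescribed sizes and equal sums as soon as the \<open>j\<close>
  largest elements reach half of the total, apart from the configuration in which the gap separates blocks of
  the prescribed sizes whose sums differ by exactly 2.
\<close>

theorem bipartition_equal_sums:
  fixes a b r :: nat
  assumes r: "r \<in> {a..b}" and T: "T = {a..b} - {r}"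
    and jk: "2 \<le> j" "j \<le> k" "card T = j + k" and s: "\<Sum>T = 2 * s"
    and X: "X \<subseteq> T" "card X = j" "s \<le> \<Sum>X"
    and blocks: "\<Sum>{r<..b} = \<Sum>{a..<r} + 2 \<Longrightarrow> card {r<..b} \<noteq> j \<and> card {r<..b} \<noteq> k"
  obtains P Q where "P \<union> Q = T" "P \<inter> Q = {}" "card P = j" "card Q = k" "\<Sum>P = s" "\<Sum>Q = s"
proof -
  have fin: "finite T" using T by simp
  define ok where "ok P Q \<longleftrightarrow> tripartition T P Q {} \<and> card P = j \<and> card Q = k" for P Q
  define val where "val m \<longleftrightarrow> (\<exists>P Q. ok P Q \<and> m = (\<Sum>P - \<Sum>Q) + (\<Sum>Q - \<Sum>P))" for m :: nat
  have cX: "card (T - X) = k" using X fin jk(3) by (simp add: card_Diff_subset finite_subset)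
  have "ok X (T - X)"
    unfolding ok_def tripartition_def using X cX by auto
  then have "\<exists>m. val m" unfolding val_def by blast
  then have "val (LEAST m. val m)" by (rule LeastI_ex)
  then obtain P Q where PQ: "ok P Q" "(LEAST m. val m) = (\<Sum>P - \<Sum>Q) + (\<Sum>Q - \<Sum>P)"
    unfolding val_def by blast
  have min: "(\<Sum>P - \<Sum>Q) + (\<Sum>Q - \<Sum>P) \<le> (p - q) + (q - p)" if res: "resizable T P Q {} p q 0" for p q
  proof -
    obtain P' Q' E where PQE: "tripartition T P' Q' E" "card P' = card P" "card Q' = card Q"
      "card E = card ({} :: nat set)" "\<Sum>P' = p" "\<Sum>Q' = q"
      using res unfolding resizable_def by blast
    moreover have "finite E" using PQE(1) fin unfolding tripartition_def by auto
    then have "E = {}" using PQE(4) by simp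
    ultimately have "ok P' Q'" using PQ(1) unfolding ok_def by simp
    then have "val ((p - q) + (q - p))" unfolding val_def using PQE(5,6) by blast
    then show ?thesis using PQ(2) Least_le by metis
  qed
  have TP: "tripartition T P Q {}" and card: "card P = j" "card Q = k"
    using PQ(1) unfolding ok_def by auto
  have TQ: "tripartition T Q P {}" by (rule tripartition_perm(1)[OF TP])
  have un: "P \<union> Q = T" "P \<inter> Q = {}" using TP unfolding tripartition_def by auto
  have finPQ: "finite P" "finite Q" using un fin by auto
  have sum: "\<Sum>P + \<Sum>Q = 2 * s"
    using sum.union_disjoint[OF finPQ un(2), of "\<lambda>x. x"] un(1) s by simp
  have no_smaller: False
    if "tripartition T P Q {}" "2 \<le> card P" "2 \<le> card Q" "\<Sum>P < \<Sum>Q" "\<not> up_closed_in T P"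
      "even (\<Sum>P + \<Sum>Q) \<and> (\<Sum>{r<..b} = \<Sum>{a..<r} + 2 \<longrightarrow> card {r<..b} \<noteq> card P \<and> card {r<..b} \<noteq> card Q)"
      "\<And>p q. resizable T P Q {} p q 0 \<Longrightarrow> \<Sum>Q - \<Sum>P \<le> (p - q) + (q - p)" for P Q
  proof -
    note hyps = that
    obtain p q where pq: "resizable ({a..b} - {r}) P Q {} p q 0" "(p - q) + (q - p) < \<Sum>Q - \<Sum>P"
      by (rule bipartition_step[OF r, of P Q]) (use hyps T in auto)
    then have "resizable T P Q {} p q 0" using T by simp
    from hyps(7)[OF this] pq(2) show False by simp
  qed
  have ev: "even (\<Sum>P + \<Sum>Q)" "even (\<Sum>Q + \<Sum>P)" using sum by presburger+
  have min': "\<And>p q. resizable T P Q {} p q 0 \<Longrightarrow> \<Sum>Q - \<Sum>P \<le> (p - q) + (q - p)"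
    "\<And>p q. resizable T Q P {} p q 0 \<Longrightarrow> \<Sum>P - \<Sum>Q \<le> (p - q) + (q - p)"
    using min resizable_perm(1) by fastforce+
  have "\<not> \<Sum>P < \<Sum>Q"
  proof
    assume less: "\<Sum>P < \<Sum>Q"
    have "\<not> up_closed_in T P"
      using up_closed_in_sum_max[of T P X] fin un(1) X card less sum by auto
    then show False
      using no_smaller[OF TP _ _ less _ _ min'(1)] blocks card jk ev by simp
  qed
  moreover have "\<not> \<Sum>Q < \<Sum>P"
  proof
    assume less: "\<Sum>Q < \<Sum>P"
    obtain Y where Y: "X \<subseteq> Y" "Y \<subseteq> T" "card Y = k"
      using exists_subset_between[of X k T] X fin jk by auto
    have "\<Sum>X \<le> \<Sum>Y" using Y fin finite_subset by (intro sum_mono2) auto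
    then have "\<not> up_closed_in T Q"
      using up_closed_in_sum_max[of T Q Y] fin un(1) X Y card less sum by auto
    then show False
      using no_smaller[OF TQ _ _ less _ _ min'(2)] blocks card jk ev by simp
  qed
  ultimately have "\<Sum>P = s" "\<Sum>Q = s" using sum by linarith+
  then show thesis using that un card by blast
qed

section \<open>Label sets beyond the first \<open>n\<close> numbers\<close>

text \<open>
  The \<open>k\<close> consecutive numbers after \<open>a\<close>.
\<close>

definition run :: "nat \<Rightarrow> nat \<Rightarrow> nat set" where
  "run a k = {a + 1..a + k}"

lemma finite_run [simp]: "finite (run a k)" and card_run [simp]: "card (run a k) = k"
  and in_run: "x \<in> run a k \<longleftrightarrow> a < x \<and> x \<le> a + k"
  unfolding run_def by auto

lemma sum_run: "2 * \<Sum>(run a k) = k * (2 * a + k + 1)"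
proof (induction k)
  case (Suc k)
  have "run a (Suc k) = insert (a + k + 1) (run a k)" unfolding run_def by auto
  then show ?case using Suc by (simp add: in_run algebra_simps)
qed (simp add: run_def)

lemma sum_run_add: "\<Sum>(run a (i + j)) = \<Sum>(run a i) + \<Sum>(run (a + i) j)"
proof -
  have "run a (i + j) = run a i \<union> run (a + i) j" "run a i \<inter> run (a + i) j = {}"
    by (auto simp: in_run)
  then show ?thesis by (simp add: sum.union_disjoint)
qed

lemma sum_run_shift: "\<Sum>(run (a + q) k) = \<Sum>(run a k) + q * k"
proof -
  have "2 * \<Sum>(run (a + q) k) = 2 * (\<Sum>(run a k) + q * k)"
    using sum_run[of "a + q" k] sum_run[of a k] by (simp add: algebra_simps)
  then show ?thesis by simp
qed

lemma sum_run_1: "\<Sum>(run a 1) = a + 1"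
  by (simp add: run_def)

text \<open>
  The numbers \<open>a + 1, \<dots>, a + k\<close> with the \<open>e\<close> largest of them raised by 1. For \<open>e \<le> k\<close> this is an interval of
  \<open>k + 1\<close> numbers with one gap; for \<open>e = 0\<close> the removed number is the top of that interval.
\<close>

definition block :: "nat \<Rightarrow> nat \<Rightarrow> nat \<Rightarrow> nat set" where
  "block a k e = run a (k + 1) - {a + k + 1 - e}"

lemma finite_block [simp]: "finite (block a k e)"
  by (simp add: block_def)

lemma card_block: "e \<le> k \<Longrightarrow> card (block a k e) = k"
  by (simp add: block_def in_run card_Diff_singleton)

lemma sum_block:
  assumes "e \<le> k"
  shows "\<Sum>(block a k e) = \<Sum>(run a k) + e"
proof -
  have "\<Sum>(run a (k + 1)) = (a + k + 1 - e) + \<Sum>(block a k e)"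
    unfolding block_def by (rule sum.remove) (use assms in \<open>auto simp: in_run\<close>)
  then show ?thesis using sum_run_add[of a k 1] sum_run_1[of "a + k"] assms by linarith
qed

lemma block_0: "block a k 0 = run a k"
  unfolding block_def by (auto simp: in_run)

text \<open>
  Every sum between the smallest one and the one of the shift by \<open>t\<close> is the sum of a block: shift by the
  quotient \<open>q\<close> and raise as many elements as the remainder \<open>e\<close> says.
\<close>

lemma block_with_sum:
  assumes k: "0 < k" and s: "\<Sum>(run a k) \<le> s" "s \<le> \<Sum>(run a k) + t * k"
  obtains q e where "e < k" "\<Sum>(block (a + q) k e) = s" "s = \<Sum>(run a k) + q * k + e"
    "q + (if e = 0 then 0 else 1) \<le> t"
    "block (a + q) k e \<subseteq> run a (k + t)"
proof -
  define d where "d = s - \<Sum>(run a k)"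
  define q e where "q = d div k" and "e = d mod k"
  have de: "d = q * k + e" unfolding q_def e_def by simp
  have e: "e < k" using k e_def by simp
  have sd: "s = \<Sum>(run a k) + q * k + e" using de s d_def by simp
  have "\<Sum>(block (a + q) k e) = s"
    using sum_block[of e k "a + q"] sum_run_shift[of a q k] e sd by simp
  moreover have dt: "q * k + e \<le> t * k" using sd s by linarith
  have qt: "q \<le> t" using dt k by (metis add_leD1 mult_le_cancel2)
  have "q < t" if "e \<noteq> 0"
  proof -
    have "q * k < t * k" using dt that by linarith
    then show ?thesis by simp
  qed
  then have "q + (if e = 0 then 0 else 1) \<le> t" using qt by auto
  moreover have "block (a + q) k e \<subseteq> run a (k + t)"
  proof (cases "e = 0")
    case True
    then show ?thesis using qt by (auto simp: block_0 in_run)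
  next
    case False
    then show ?thesis using \<open>e \<noteq> 0 \<Longrightarrow> q < t\<close> by (auto simp: block_def in_run)
  qed
  ultimately show thesis using that[OF e] sd by blast
qed

text \<open>
  Three disjoint sets of labels from \<open>{1..N}\<close> of the sizes \<open>a\<close>, \<open>b\<close>, \<open>c\<close> with equal sums.
\<close>

definition equal_sum_triple :: "nat \<Rightarrow> nat \<Rightarrow> nat \<Rightarrow> nat \<Rightarrow> bool" where
  "equal_sum_triple N a b c \<longleftrightarrow> (\<exists>A B C. A \<union> B \<union> C \<subseteq> {1..N} \<and> A \<inter> B = {} \<and> A \<inter> C = {} \<and> B \<inter> C = {} \<and>
     card A = a \<and> card B = b \<and> card C = c \<and> \<Sum>A = \<Sum>B \<and> \<Sum>B = \<Sum>C)"

lemma equal_sum_tripleI: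
  assumes "A \<union> B \<union> C \<subseteq> {1..N}" "A \<inter> B = {}" "A \<inter> C = {}" "B \<inter> C = {}"
    and "\<Sum>A = s" "\<Sum>B = s" "\<Sum>C = s"
  shows "equal_sum_triple N (card A) (card B) (card C)"
  unfolding equal_sum_triple_def using assms by (intro exI[of _ A] exI[of _ B] exI[of _ C]) simp

lemma split_block:
  assumes "2 \<le> b" "b \<le> c" "m = b + c" "e < b"
    and s: "\<Sum>(run 0 m) + e = 2 * s" and low: "\<Sum>(run 0 c) \<le> s"
  obtains B C where "B \<union> C = block 0 m e" "B \<inter> C = {}" "card B = b" "card C = c" "\<Sum>B = s" "\<Sum>C = s"
proof -
  have e: "e \<le> m" using assms by simp
  have sub: "run 0 c \<subseteq> block 0 m e" using assms unfolding block_def by (auto simp: in_run)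
  have tot: "\<Sum>(block 0 m e) = 2 * s" using sum_block[OF e, of 0] s by simp
  show thesis
  proof (rule bipartition_equal_sums[of "m + 1 - e" 1 "m + 1" "block 0 m e" b c s "block 0 m e - run 0 c"])
    show "m + 1 - e \<in> {1..m + 1}" using e by simp
    show "block 0 m e = {1..m + 1} - {m + 1 - e}" unfolding block_def run_def by simp
    show "card (block 0 m e) = b + c" using card_block[OF e] assms by simp
    show "card (block 0 m e - run 0 c) = b"
      using sub card_block[OF e] assms by (simp add: card_Diff_subset)
    show "s \<le> \<Sum>(block 0 m e - run 0 c)"
      using sum.subset_diff[OF sub finite_block, of "\<lambda>x. x"] tot low by simp
    show "card {m + 1 - e<..m + 1} \<noteq> b \<and> card {m + 1 - e<..m + 1} \<noteq> c"
      using assms by simp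
  qed (use assms tot that in auto)
qed

text \<open>
  The regime in which the \<open>a\<close> top labels \<open>run m a\<close> sum to less than half of the remaining ones. The small labels
  \<open>{1..m}\<close> are split into two halves of sum \<open>s\<close>, and the top labels are spread upwards until they sum to \<open>s\<close>.
  If the sum of \<open>{1..m}\<close> is odd, \<open>m\<close> is first replaced by \<open>m + 1\<close>, so that the smallest part has to avoid \<open>m + 1\<close>.
\<close>

theorem equal_sum_triple_large_top:
  assumes sz: "2 \<le> a" "a \<le> b" "b \<le> c" "m = b + c"
    and top: "2 * \<Sum>(run m a) < \<Sum>(run 0 m)" and low: "2 * \<Sum>(run 0 c) \<le> \<Sum>(run 0 m)"
    and t: "\<Sum>(run 0 m) \<le> 2 * (\<Sum>(run m a) + t * a)"
  shows "equal_sum_triple (m + a + t) a b c"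
proof -
  define s where "s = (\<Sum>(run 0 m) + 1) div 2"
  have s: "\<Sum>(run m a) \<le> s" "s \<le> \<Sum>(run m a) + t * a" "\<Sum>(run 0 c) \<le> s"
  proof -
    have "x \<le> 2 * ((x + 1) div 2) \<and> 2 * ((x + 1) div 2) \<le> x + 1" for x :: nat by presburger
    then have "\<Sum>(run 0 m) \<le> 2 * s" "2 * s \<le> \<Sum>(run 0 m) + 1" unfolding s_def by blast+
    moreover have "\<sigma> \<le> y" if "2 * \<sigma> \<le> x + 1" "x \<le> 2 * y" for \<sigma> x y :: nat
      using that by presburger
    ultimately show "\<Sum>(run m a) \<le> s" "s \<le> \<Sum>(run m a) + t * a" "\<Sum>(run 0 c) \<le> s"
      using top t low by (linarith, blast, linarith)
  qed
  have finish: ?thesis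
    if "A \<subseteq> run 0 (m + a + t)" "card A = a" "\<Sum>A = \<sigma>" "e < b" "A \<inter> block 0 m e = {}"
      "\<Sum>(run 0 m) + e = 2 * \<sigma>" "block 0 m e \<subseteq> run 0 (m + a + t)" "s \<le> \<sigma>" for A e \<sigma>
  proof -
    note hyps = that
    have "2 \<le> b" "\<Sum>(run 0 c) \<le> \<sigma>" using sz that(8) s(3) by linarith+
    then obtain B C where BC: "B \<union> C = block 0 m e" "B \<inter> C = {}" "card B = b" "card C = c" "\<Sum>B = \<sigma>" "\<Sum>C = \<sigma>"
      by (rule split_block[OF _ sz(3,4) hyps(4,6)])
    have "A \<union> B \<union> C \<subseteq> {1..m + a + t}" using BC(1) that(1,7) unfolding run_def by auto
    moreover have "A \<inter> B = {}" "A \<inter> C = {}" using BC(1) that(5) by blast+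
    ultimately have "equal_sum_triple (m + a + t) (card A) (card B) (card C)"
      using BC(2,5,6) hyps(3) by (intro equal_sum_tripleI)
    then show ?thesis using BC(3,4) hyps(2) by simp
  qed
  obtain q e where qe: "e < a" "\<Sum>(block (m + q) a e) = s" "s = \<Sum>(run m a) + q * a + e"
    "q + (if e = 0 then 0 else 1) \<le> t" "block (m + q) a e \<subseteq> run m (a + t)"
    by (rule block_with_sum[OF _ s(1,2)]) (use sz in simp_all)
  have sub: "block (m + q) a e \<subseteq> run 0 (m + a + t)" using qe(5) by (auto simp: in_run)
  have cA: "card (block (m + q) a e) = a" using card_block qe(1) by simp
  show ?thesis
  proof (cases "even (\<Sum>(run 0 m))")
    case True
    then have "\<Sum>(run 0 m) + 0 = 2 * s" unfolding s_def by simp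
    moreover have "block (m + q) a e \<inter> block 0 m 0 = {}"
      using qe(5) unfolding block_0 by (auto simp: in_run)
    moreover have "block 0 m 0 \<subseteq> run 0 (m + a + t)" by (auto simp: block_0 in_run)
    ultimately show ?thesis
      using finish[OF sub cA qe(2), of 0] sz by simp
  next
    case False
    then have s2: "\<Sum>(run 0 m) + 1 = 2 * s" unfolding s_def by simp
    have t1: "1 \<le> t" using t top by (cases t) auto
    have sub1: "block 0 m 1 \<subseteq> run 0 (m + a + t)" "block 0 m 3 \<subseteq> run 0 (m + a + t)"
      using t1 sz by (auto simp: block_def in_run)
    show ?thesis
    proof (cases "q = 0")
      case False
      then have "block (m + q) a e \<inter> block 0 m 1 = {}"
        by (auto simp: block_def in_run)
      then show ?thesis using finish[OF sub cA qe(2) _ _ s2 sub1(1)] sz by simp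
    next
      case True
      \<comment> \<open>Here the block for the smallest part contains \<open>m + 1\<close>. Lower \<open>m + 1\<close> to \<open>m\<close> and raise one more element
        instead. This fails only if all elements but \<open>m + 1\<close> are raised already; then the smallest part becomes
        \<open>run (m + 1) a\<close>, all sums grow by 1, and \<open>m - 2\<close> is dropped from \<open>{1..m + 1}\<close>.\<close>
      show ?thesis
      proof (cases "e + 2 \<le> a")
        case e2: True
        let ?A = "insert m (block (m + 1) (a - 1) (e + 1) )"
        have "card (block (m + 1) (a - 1) (e + 1)) = a - 1"
          by (rule card_block) (use e2 in simp)
        moreover have m: "m \<notin> block (m + 1) (a - 1) (e + 1)" by (simp add: block_def in_run)
        ultimately have "card ?A = a" using sz by simp
        moreover have "\<Sum>?A = s"
        proof -
          have "\<Sum>(block (m + 1) (a - 1) (e + 1)) = \<Sum>(run (m + 1) (a - 1)) + (e + 1)"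
            by (rule sum_block) (use e2 in simp)
          moreover have "\<Sum>(run m a) = \<Sum>(run m 1) + \<Sum>(run (m + 1) (a - 1))"
            using sum_run_add[of m 1 "a - 1"] sz by simp
          ultimately show ?thesis using m qe(3) True sum_run_1[of m] by simp
        qed
        moreover have "?A \<inter> block 0 m 1 = {}"
          using e2 by (auto simp: block_def in_run)
        moreover have "?A \<subseteq> run 0 (m + a + t)"
          using t1 sz by (auto simp: block_def in_run)
        ultimately show ?thesis using finish[of ?A s 1] s2 sub1(1) sz by simp
      next
        case False
        then have ea: "e = a - 1" using qe(1) by simp
        have eq: "\<Sum>(run 0 m) + 3 = 2 * (s + 1)" using s2 by simp
        \<comment> \<open>For \<open>b < 4\<close> the sums would have to satisfy one of two quadratic equations without solutions.\<close>
        have b4: "4 \<le> b"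
        proof (rule ccontr)
          assume "\<not> 4 \<le> b"
          then have a: "a = 2 \<or> a = 3" using sz by auto
          have "2 * (2 * \<Sum>(run m a) + 2 * (a - 1)) = 2 * \<Sum>(run 0 m) + 2"
            using s2 qe(3) True ea by simp
          then have "2 * (a * (2 * m + a + 1) + 2 * (a - 1)) = m * (m + 1) + 2"
            using sum_run[of m a] sum_run[of 0 m] by simp
          then have "m * m = 7 * m + 14 \<or> m * m = 11 * m + 30"
            using a by (auto simp: algebra_simps)
          then show False
          proof
            assume h: "m * m = 7 * m + 14"
            have "m \<le> 8 \<or> 9 \<le> m" by linarith
            then show False
            proof
              assume "m \<le> 8" then have "m * m \<le> 8 * m" by simp
              with h have "14 \<le> m" by linarith
              with \<open>m \<le> 8\<close> show False by simp
            next
              assume "9 \<le> m" then have "9 * m \<le> m * m" by simp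
              with h have "m \<le> 7" by linarith
              with \<open>9 \<le> m\<close> show False by simp
            qed
          next
            assume h: "m * m = 11 * m + 30"
            have "m \<le> 13 \<or> 14 \<le> m" by linarith
            then show False
            proof
              assume "m \<le> 13" then have "m * m \<le> 13 * m" by simp
              with h have "15 \<le> m" by linarith
              with \<open>m \<le> 13\<close> show False by simp
            next
              assume "14 \<le> m" then have "14 * m \<le> m * m" by simp
              with h have "m \<le> 10" by linarith
              with \<open>14 \<le> m\<close> show False by simp
            qed
          qed
        qed
        have "\<Sum>(run (m + 1) a) = s + 1"
          using sum_run_shift[of m 1 a] qe(3) True ea sz by simp
        moreover have "run (m + 1) a \<inter> block 0 m 3 = {}" by (auto simp: block_def in_run)
        moreover have "run (m + 1) a \<subseteq> run 0 (m + a + t)" using t1 by (auto simp: in_run)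
        ultimately show ?thesis using finish[of "run (m + 1) a" "s + 1" 3] eq sub1(2) b4 by simp
      qed
    qed
  qed
qed

text \<open>
  In the regime of the next theorem the two smaller parts differ in size by less than a factor of 2.
\<close>

lemma parts_comparable:
  assumes "2 \<le> a" "a \<le> b" "b \<le> c" "m = b + c"
    and top: "\<Sum>(run 0 m) \<le> 2 * \<Sum>(run m a)"
    and low: "\<Sum>(run c (b + a)) < 2 * \<Sum>(run 0 c)"
  shows "b < 2 * a"
proof (rule ccontr)
  assume "\<not> b < 2 * a"
  then obtain u where b: "b = 2 * a + u" by (metis le_iff_add not_less)
  have "m * (m + 1) \<le> 2 * (a * (2 * m + a + 1))"
    using top sum_run[of 0 m] sum_run[of m a] by simp
  then have 1: "(2 * a + u + c) * (2 * a + u + c + 1) \<le> 2 * (a * (2 * (2 * a + u + c) + a + 1))"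
    using assms(4) b by simp
  have 2: "(3 * a + u) * (2 * c + 3 * a + u + 1) < 2 * (c * (c + 1))"
    using low sum_run[of c "b + a"] sum_run[of 0 c] b by (simp add: algebra_simps)
  have 3: "c * c + c \<le> 6 * (a * a)" using 1 by (simp add: algebra_simps)
  have "9 * (a * a) + 6 * (a * c) + 3 * a < 2 * (c * c) + 2 * c"
    using 2 by (simp add: algebra_simps)
  with 3 have "6 * (a * c) + 3 * a < 3 * (a * a)" by linarith
  moreover have "a * a \<le> a * c" using assms by simp
  ultimately show False by linarith
qed

text \<open>
  The regime in which the \<open>c\<close> smallest labels sum to more than a third of the total. They form the largest part,
  and the other two parts split a block of \<open>a + b\<close> labels above them whose sum is twice as large.
\<close>

theorem equal_sum_triple_small_low:
  assumes sz: "2 \<le> a" "a \<le> b" "b \<le> c" "m = b + c"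
    and top: "\<Sum>(run 0 m) \<le> 2 * \<Sum>(run m a)"
    and low: "\<Sum>(run c (b + a)) < 2 * \<Sum>(run 0 c)"
    and h: "\<Sum>(run 0 c) \<le> \<Sum>(run c b) + h * b"
  shows "equal_sum_triple (m + a + h + 1) a b c"
proof -
  let ?c = "\<Sum>(run 0 c)" and ?B = "\<Sum>(run c b)" and ?A = "\<Sum>(run m a)"
  have m_eq: "\<Sum>(run 0 m) = ?c + ?B" using sum_run_add[of 0 c b] sz by (simp add: add.commute)
  have k_eq: "\<Sum>(run c (b + a)) = ?B + ?A" using sum_run_add[of c b a] sz by (simp add: add.commute)
  have b2a: "b < 2 * a" by (rule parts_comparable[OF sz top low])
  have ha: "?c \<le> ?A + h * a"
  proof -
    have "h * b \<le> h * (2 * a)" using b2a by (intro mult_le_mono2) simp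
    also have "\<dots> = 2 * (h * a)" by simp
    finally show ?thesis using h top m_eq by linarith
  qed
  obtain q e where qe: "e < b + a" "\<Sum>(block (c + q) (b + a) e) = 2 * ?c"
    "2 * ?c = \<Sum>(run c (b + a)) + q * (b + a) + e"
    "q + (if e = 0 then 0 else 1) \<le> h" "block (c + q) (b + a) e \<subseteq> run c (b + a + h)"
  proof (rule block_with_sum[of "b + a" c "2 * ?c" h])
    show "2 * ?c \<le> \<Sum>(run c (b + a)) + h * (b + a)"
      using k_eq h ha by (simp add: algebra_simps)
  qed (use sz low that in auto)
  let ?L = "c + q"
  let ?T = "block ?L (b + a) e"
  have finish: ?thesis
    if "A \<union> B \<subseteq> run c (b + a + h + 1)" "A \<inter> B = {}" "card A = a" "card B = b" "\<Sum>A = ?c" "\<Sum>B = ?c" for A B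
  proof -
    have "A \<union> B \<union> run 0 c \<subseteq> {1..m + a + h + 1}" 
      using that(1) sz by (auto simp: in_run subset_iff)
    moreover have "A \<inter> run 0 c = {}" "B \<inter> run 0 c = {}" using that(1) by (auto simp: in_run subset_iff)
    ultimately have "equal_sum_triple (m + a + h + 1) (card A) (card B) (card (run 0 c))"
      using that(2,5,6) by (intro equal_sum_tripleI) simp_all
    then show ?thesis using that(3,4) by simp
  qed
  \<comment> \<open>The \<open>a\<close> largest elements of the block reach half of its sum. The total shift \<open>q * (b + a) + e\<close> is the sum of the
    deficits \<open>D\<close> of the top \<open>a\<close> labels and \<open>?c - ?B\<close> of the next \<open>b\<close> ones; as \<open>2 * D \<le> ?c - ?B\<close> and \<open>b < 2 * a\<close>,
    the proportional share of the top labels covers \<open>D\<close>.\<close>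
  have key: "?c \<le> ?A + q * a + min e a"
  proof (rule ccontr)
    assume "\<not> ?thesis"
    then have gt: "?A + (q * a + min e a) < ?c" by simp
    define D where "D = ?c - ?A"
    have D: "?c = ?A + D" "q * a + min e a + 1 \<le> D" unfolding D_def using gt by linarith+
    have E: "?B + 2 * D \<le> ?c" using D(1) top m_eq by simp
    have tot: "D + (?c - ?B) = q * (b + a) + e" using D(1) E qe(3) k_eq by simp
    have "b * D \<le> a * (?c - ?B)"
    proof -
      have "b * D \<le> (2 * a) * D" using b2a by simp
      also have "\<dots> = a * (2 * D)" by simp
      also have "\<dots> \<le> a * (?c - ?B)" using E by (intro mult_le_mono2) simp
      finally show ?thesis .
    qed
    then have "(b + a) * D \<le> a * (D + (?c - ?B))" by (simp add: algebra_simps)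
    then have 1: "(b + a) * D \<le> a * (q * (b + a) + e)" using tot by simp
    have 2: "(b + a) * (q * a + min e a + 1) \<le> (b + a) * D" by (rule mult_le_mono2[OF D(2)])
    have "(b + a) * (q * a + min e a + 1) \<le> a * (q * (b + a) + e)" using 1 2 by linarith
    moreover have "(b + a) * (q * a + M + 1) \<le> a * (q * (b + a) + e) \<Longrightarrow> (b + a) * M + (b + a) \<le> a * e" for M
      by (simp add: algebra_simps)
    ultimately have 3: "(b + a) * min e a + (b + a) \<le> a * e" by blast
    show False
    proof (cases "e \<le> a")
      case True
      then have "min e a = e" by simp
      from 3[unfolded this] have "a * e + b * e + b + a \<le> a * e" by (simp add: algebra_simps)
      then show False using sz by simp
    next
      case False
      then have "min e a = a" by simp
      from 3[unfolded this] have "(b + a) * a + (b + a) \<le> a * e" by simp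
      moreover have "a * e \<le> a * (b + a)" using qe(1) by simp
      ultimately show False using sz by (simp add: algebra_simps)
    qed
  qed
  have topL: "\<Sum>(run (?L + b) a) = ?A + q * a"
    using sum_run_shift[of m q a] sz by (simp add: algebra_simps)
  obtain X where X: "X \<subseteq> ?T" "card X = a" "?c \<le> \<Sum>X"
  proof (cases "e \<le> a")
    case True
    show thesis
    proof (rule that[of "block (?L + b) a e"])
      show "block (?L + b) a e \<subseteq> ?T" by (auto simp: block_def in_run add_ac)
      show "card (block (?L + b) a e) = a" using card_block True by simp
      show "?c \<le> \<Sum>(block (?L + b) a e)" using sum_block[OF True, of "?L + b"] key topL True by simp
    qed
  next
    case False
    show thesis
    proof (rule that[of "run (?L + b + 1) a"])
      show "run (?L + b + 1) a \<subseteq> ?T" using False qe(1) by (auto simp: block_def in_run)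
      show "?c \<le> \<Sum>(run (?L + b + 1) a)" using sum_run_shift[of "?L + b" 1 a] key topL False by simp
    qed simp
  qed
  let ?r = "?L + (b + a) + 1 - e"
  show ?thesis
  proof (cases "e = a \<and> \<Sum>{?r<..?L + (b + a) + 1} = \<Sum>{?L + 1..<?r} + 2")
    case True
    \<comment> \<open>In the exceptional configuration of the splitting theorem the two parts are written down explicitly; the top
      element of the block is raised by 1, which costs the summand 1 in the bound for the labels.\<close>
    then have e: "e = a" by blast
    have runs: "{?r<..?L + (b + a) + 1} = run (?L + b + 1) a" "{?L + 1..<?r} = run ?L b"
      using e by (auto simp: in_run)
    have d: "\<Sum>(run (?L + b + 1) a) = \<Sum>(run ?L b) + 2"
      using True unfolding runs by blast
    have "\<Sum>(run ?L (b + a)) + a = 2 * ?c" using qe(2) sum_block[of e "b + a" ?L] e by simp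
    then have lo: "\<Sum>(run ?L b) + 1 = ?c"
      using d sum_run_add[of ?L b a] sum_run_shift[of "?L + b" 1 a] by simp
    let ?B' = "block ?L b 1"
    let ?A' = "{?L + b} \<union> run (?L + b + 2) (a - 2) \<union> {?L + b + a + 2}"
    have "\<Sum>?B' = ?c" "card ?B' = b" using sum_block[of 1 b ?L] card_block[of 1 b ?L] lo sz by auto
    moreover have "card ?A' = a" using sz by (auto simp: in_run card_insert_if)
    moreover have "\<Sum>?A' = ?c"
    proof -
      have "\<Sum>(run (?L + b + 1) a) = \<Sum>(run (?L + b + 1) 1) + \<Sum>(run (?L + b + 2) (a - 2)) + \<Sum>(run (?L + b + a) 1)"
        using sum_run_add[of "?L + b + 1" 1 "a - 1"] sum_run_add[of "?L + b + 2" "a - 2" 1] sz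
        by (simp add: numeral_2_eq_2 Suc_diff_Suc)
      moreover have "\<Sum>?A' = (?L + b) + \<Sum>(run (?L + b + 2) (a - 2)) + (?L + b + a + 2)"
        using sz by (simp add: in_run)
      ultimately show ?thesis using d lo sum_run_1[of "?L + b + 1"] sum_run_1[of "?L + b + a"] by simp
    qed
    moreover have "?A' \<inter> ?B' = {}" by (auto simp: block_def in_run)
    moreover have "?A' \<union> ?B' \<subseteq> run c (b + a + h + 1)"
      using qe(4) e sz by (auto simp: block_def in_run)
    ultimately show ?thesis by (intro finish[of ?A' ?B']) auto
  next
    case False
    obtain A B where "A \<union> B = ?T" "A \<inter> B = {}" "card A = a" "card B = b" "\<Sum>A = ?c" "\<Sum>B = ?c"
    proof (rule bipartition_equal_sums[of ?r "?L + 1" "?L + (b + a) + 1" ?T a b ?c X])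
      show "?r \<in> {?L + 1..?L + (b + a) + 1}" using qe(1) by simp
      show "?T = {?L + 1..?L + (b + a) + 1} - {?r}" unfolding block_def run_def by (simp add: add.assoc)
      show "card ?T = a + b" using card_block qe(1) by simp
    next
      assume eq: "\<Sum>{?r<..?L + (b + a) + 1} = \<Sum>{?L + 1..<?r} + 2"
      then have "e \<noteq> a" using False by blast
      moreover have "e \<noteq> b"
      proof
        assume e: "e = b"
        have runs: "{?r<..?L + (b + a) + 1} = run (?L + a + 1) b" "{?L + 1..<?r} = run ?L a"
          using e by (auto simp: in_run)
        have "\<Sum>(run (?L + a + 1) b) = \<Sum>(run ?L a) + 2" using eq unfolding runs .
        moreover have "\<Sum>(run (?L + a + 1) b) = \<Sum>(run (?L + a + 1) a) + \<Sum>(run (?L + a + 1 + a) (b - a))"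
          using sum_run_add[of "?L + a + 1" a "b - a"] sz by simp
        moreover have "\<Sum>(run (?L + a + 1) a) = \<Sum>(run ?L a) + (a + 1) * a"
          using sum_run_shift[of ?L "a + 1" a] by (simp add: add.assoc)
        ultimately have "(a + 1) * a \<le> 2" by simp
        moreover have "3 * 2 \<le> (a + 1) * a" using sz by (intro mult_le_mono) auto
        ultimately show False by simp
      qed
      ultimately show "card {?r<..?L + (b + a) + 1} \<noteq> a \<and> card {?r<..?L + (b + a) + 1} \<noteq> b"
        using qe(1) by simp
    qed (use sz X qe(2) that in auto)
    moreover have "?T \<subseteq> run c (b + a + h + 1)" using qe(5) by (auto simp: in_run)
    ultimately show ?thesis by (intro finish[of A B]) auto
  qed
qed

section \<open>The index of complete multipartite graphs\<close>

text \<open>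
  The label sets over which the infimum \<open>i(G)\<close> is taken.
\<close>

definition admissible :: "('a, 'b) pre_digraph \<Rightarrow> nat set \<Rightarrow> bool" where
  "admissible G S \<longleftrightarrow> finite S \<and> card S = card (verts G) \<and> (\<forall>s\<in>S. 0 < s) \<and> set_magic S G"

lemma magic_inf_admissible: "magic_inf G = (INF S \<in> Collect (admissible G). ereal (real (Max S)))"
  unfolding magic_inf_def admissible_def by simp

lemma distance_magic_index_leI:
  assumes S: "admissible G S" "S \<subseteq> {1..card (verts G) + t}" and pos: "0 < card (verts G)"
  shows "distance_magic_index G \<le> ereal (real t)"
proof -
  have "Max S \<le> card (verts G) + t"
  proof -
    have "S \<noteq> {}" "finite S" using S(1) pos unfolding admissible_def by auto
    then show ?thesis using S(2) by (subst Max_le_iff) auto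
  qed
  have "magic_inf G \<le> ereal (real (Max S))"
    unfolding magic_inf_admissible using S(1) by (intro INF_lower) simp
  also have "\<dots> \<le> ereal (real (card (verts G)) + real t)"
    using \<open>Max S \<le> _\<close> by simp
  finally show ?thesis unfolding distance_magic_index_def
    by (cases "magic_inf G") auto
qed

lemma distance_magic_index_geI:
  assumes "\<And>S. admissible G S \<Longrightarrow> x + real (card (verts G)) \<le> real (Max S)"
  shows "ereal x \<le> distance_magic_index G"
proof -
  have "ereal (x + real (card (verts G))) \<le> magic_inf G"
    unfolding magic_inf_admissible using assms by (intro INF_greatest) simp
  then show ?thesis unfolding distance_magic_index_def
    by (cases "magic_inf G") auto
qed

text \<open>The infimum is attained, because the labels are natural numbers.\<close>

lemma distance_magic_index_cases:
  assumes "0 < card (verts G)"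
  obtains "distance_magic_index G = \<infinity>"
  | S t where "admissible G S" "S \<subseteq> {1..card (verts G) + t}" "distance_magic_index G = ereal (real t)"
proof (cases "\<exists>S. admissible G S")
  case False
  then have empty: "Collect (admissible G) = {}" by blast
  have "magic_inf G = \<infinity>"
    unfolding magic_inf_admissible empty by (simp add: top_ereal_def)
  then show thesis using that(1) unfolding distance_magic_index_def by simp
next
  case True
  define N where "N = (LEAST k. \<exists>S. admissible G S \<and> Max S = k)"
  have "\<exists>S. admissible G S \<and> Max S = N"
    unfolding N_def by (rule LeastI_ex) (use True in blast)
  then obtain S where S: "admissible G S" "Max S = N" by blast
  have min: "N \<le> Max S'" if "admissible G S'" for S'
    unfolding N_def by (rule Least_le) (use that in blast)
  have sub: "S \<subseteq> {1..N}"
    using S unfolding admissible_def by (auto simp: Suc_le_eq)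
  have "card S \<le> N" using card_mono[OF _ sub] by simp
  then have nN: "card (verts G) \<le> N" using S(1) unfolding admissible_def by simp
  have "magic_inf G = ereal (real N)"
    unfolding magic_inf_admissible
  proof (rule antisym)
    show "(INF S \<in> Collect (admissible G). ereal (real (Max S))) \<le> ereal (real N)"
      using S by (intro INF_lower2[of S]) auto
    show "ereal (real N) \<le> (INF S \<in> Collect (admissible G). ereal (real (Max S)))"
      using min by (intro INF_greatest) simp
  qed
  then have "distance_magic_index G = ereal (real (N - card (verts G)))"
    unfolding distance_magic_index_def using nN by (simp add: of_nat_diff)
  then show thesis using that(2)[OF S(1), of "N - card (verts G)"] sub nN by simp
qed

lemma sum_image_bij:
  fixes l :: "'a \<Rightarrow> nat"
  assumes "bij_betw l X S" "U \<subseteq> X"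
  shows "\<Sum>(l ` U) = sum l U" "card (l ` U) = card U"
proof -
  have "inj_on l U" using assms by (meson bij_betw_imp_inj_on inj_on_subset)
  then show "\<Sum>(l ` U) = sum l U" "card (l ` U) = card U"
    by (simp_all add: sum.reindex card_image)
qed

lemma finite_parts_bij:
  assumes fin: "finite U" "finite A" and c: "card A = card U"
  obtains f where "bij_betw f U A"
  using finite_same_card_bij[OF fin] c by metis

lemma complete_tripartite_verts:
  assumes "complete_tripartite_digraph a b c G"
  shows "card (verts G) = a + b + c"
proof -
  obtain U V W where G: "graph G" "verts G = U \<union> V \<union> W" "U \<inter> V = {}" "U \<inter> W = {}" "V \<inter> W = {}"
      "card U = a" "card V = b" "card W = c"
    using assms unfolding complete_tripartite_digraph_def by blast
  interpret graph G by fact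
  have "finite U" "finite V" "finite W" using finite_verts G(2) by auto
  moreover have "(U \<union> V) \<inter> W = {}" using G by blast
  ultimately show ?thesis using G by (simp add: card_Un_disjoint)
qed

theorem admissible_complete_tripartite_iff:
  assumes G: "complete_tripartite_digraph a b c G" and pos: "0 < a" "0 < b" "0 < c"
  shows "admissible G S \<longleftrightarrow> (\<exists>A B C. S = A \<union> B \<union> C \<and> S \<subseteq> {0<..} \<and> A \<inter> B = {} \<and> A \<inter> C = {} \<and> B \<inter> C = {} \<and>
     card A = a \<and> card B = b \<and> card C = c \<and> \<Sum>A = \<Sum>B \<and> \<Sum>B = \<Sum>C)"
    (is "_ \<longleftrightarrow> ?R")
proof -
  obtain U V W where G': "graph G" and vs: "verts G = U \<union> V \<union> W" and dj: "U \<inter> V = {}" "U \<inter> W = {}" "V \<inter> W = {}"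
      and cards: "card U = a" "card V = b" "card W = c"
      and arcs: "arcs_ends G = U \<times> V \<union> V \<times> U \<union> U \<times> W \<union> W \<times> U \<union> V \<times> W \<union> W \<times> V"
    using G unfolding complete_tripartite_digraph_def by blast
  interpret graph G by fact
  have fin: "finite U" "finite V" "finite W" using finite_verts vs by auto
  have ne: "U \<noteq> {}" "V \<noteq> {}" "W \<noteq> {}" using pos cards by auto
  have nb: "u \<in> U \<Longrightarrow> neighborhood G u = V \<union> W" "u \<in> V \<Longrightarrow> neighborhood G u = U \<union> W"
    "u \<in> W \<Longrightarrow> neighborhood G u = U \<union> V" for u
    unfolding neighborhood_def arcs using dj by blast+
  have sums: "sum l (V \<union> W) = sum l V + sum l W" "sum l (U \<union> W) = sum l U + sum l W"
    "sum l (U \<union> V) = sum l U + sum l V" for l :: "'a \<Rightarrow> nat"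
    using fin dj by (simp_all add: sum.union_disjoint)
  have magic: "(\<exists>\<mu>. \<forall>u\<in>verts G. sum l (neighborhood G u) = \<mu>) \<longleftrightarrow> sum l U = sum l V \<and> sum l V = sum l W" for l :: "'a \<Rightarrow> nat"
  proof
    assume "\<exists>\<mu>. \<forall>u\<in>verts G. sum l (neighborhood G u) = \<mu>"
    then obtain \<mu> where \<mu>: "\<And>u. u \<in> verts G \<Longrightarrow> sum l (neighborhood G u) = \<mu>" by blast
    obtain u v w where "u \<in> U" "v \<in> V" "w \<in> W" using ne by blast
    then have "sum l V + sum l W = \<mu>" "sum l U + sum l W = \<mu>" "sum l U + sum l V = \<mu>"
      using \<mu>[of u] \<mu>[of v] \<mu>[of w] nb sums vs by simp_all
    then show "sum l U = sum l V \<and> sum l V = sum l W" by linarith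
  next
    assume "sum l U = sum l V \<and> sum l V = sum l W"
    then have "\<forall>u\<in>verts G. sum l (neighborhood G u) = 2 * sum l W"
      unfolding vs using nb sums by auto
    then show "\<exists>\<mu>. \<forall>u\<in>verts G. sum l (neighborhood G u) = \<mu>" by blast
  qed
  show ?thesis
  proof
    assume "admissible G S"
    then obtain l where l: "bij_betw l (verts G) S" "sum l U = sum l V" "sum l V = sum l W"
      and S: "S \<subseteq> {0<..}"
      unfolding admissible_def set_magic_def using magic by (metis greaterThan_iff subsetI)
    have inj: "inj_on l (verts G)" and im: "l ` verts G = S" using l(1) unfolding bij_betw_def by auto
    have sub: "U \<subseteq> verts G" "V \<subseteq> verts G" "W \<subseteq> verts G" using vs by auto
    have "S = l ` U \<union> l ` V \<union> l ` W" using im vs by (simp add: image_Un)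
    moreover have "l ` U \<inter> l ` V = {}" "l ` U \<inter> l ` W = {}" "l ` V \<inter> l ` W = {}"
      using inj_on_image_Int[OF inj] sub dj by (metis image_empty)+
    ultimately show ?R
      using S sum_image_bij[OF l(1)] sub cards l(2,3) by metis
  next
    assume ?R
    then obtain A B C where S: "S = A \<union> B \<union> C" "S \<subseteq> {0<..}" "A \<inter> B = {}" "A \<inter> C = {}" "B \<inter> C = {}"
      "card A = a" "card B = b" "card C = c" "\<Sum>A = \<Sum>B" "\<Sum>B = \<Sum>C" by blast
    have finA: "finite A" "finite B" "finite C" using S pos card_ge_0_finite by blast+
    obtain f g h where f: "bij_betw f U A" and g: "bij_betw g V B" and h: "bij_betw h W C"
      using finite_parts_bij fin finA cards S by metis
    define l where "l x = (if x \<in> U then f x else if x \<in> V then g x else h x)" for x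
    have lU: "bij_betw l U A" using f by (subst bij_betw_cong[of U l f]) (auto simp: l_def)
    have lV: "bij_betw l V B" using g dj by (subst bij_betw_cong[of V l g]) (auto simp: l_def)
    have lW: "bij_betw l W C" using h dj by (subst bij_betw_cong[of W l h]) (auto simp: l_def)
    have lS: "bij_betw l (verts G) S"
      unfolding vs S(1) using bij_betw_combine[OF bij_betw_combine[OF lU lV] lW] S(3-5) by blast
    have "sum l U = \<Sum>A" "sum l V = \<Sum>B" "sum l W = \<Sum>C"
      using sum_image_bij(1)[OF lU] sum_image_bij(1)[OF lV] sum_image_bij(1)[OF lW] lU lV lW
      unfolding bij_betw_def by auto
    then have "set_magic S G" unfolding set_magic_def using lS magic S by metis
    moreover have "card S = card (verts G)" using bij_betw_same_card[OF lS] by simp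
    ultimately show "admissible G S" unfolding admissible_def using S finA by auto
  qed
qed

lemma admissible_complete_bipartite_parts:
  assumes H: "complete_bipartite_digraph b c H" and pos: "0 < b" "0 < c" and S: "admissible H S"
  obtains B C where "S = B \<union> C" "B \<inter> C = {}" "card B = b" "card C = c" "\<Sum>B = \<Sum>C"
proof -
  obtain V W where H': "graph H" and vs: "verts H = V \<union> W" and dj: "V \<inter> W = {}"
      and cards: "card V = b" "card W = c" and arcs: "arcs_ends H = V \<times> W \<union> W \<times> V"
    using H unfolding complete_bipartite_digraph_def by blast
  have nb: "u \<in> V \<Longrightarrow> neighborhood H u = W" "u \<in> W \<Longrightarrow> neighborhood H u = V" for u
    unfolding neighborhood_def arcs using dj by blast+
  obtain l \<mu> where l: "bij_betw l (verts H) S" "\<And>u. u \<in> verts H \<Longrightarrow> sum l (neighborhood H u) = \<mu>"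
    using S unfolding admissible_def set_magic_def by blast
  obtain v w where "v \<in> V" "w \<in> W" using pos cards by (metis card.empty ex_in_conv less_irrefl)
  then have "sum l V = sum l W" using l(2)[of v] l(2)[of w] nb vs by simp
  moreover have inj: "inj_on l (verts H)" and im: "l ` verts H = S" using l(1) unfolding bij_betw_def by auto
  moreover have sub: "V \<subseteq> verts H" "W \<subseteq> verts H" using vs by auto
  moreover have "S = l ` V \<union> l ` W" using im vs by (simp add: image_Un)
  moreover have "l ` V \<inter> l ` W = {}"
    using inj_on_image_Int[OF inj] sub dj by (metis image_empty)
  ultimately show thesis
    using that[of "l ` V" "l ` W"] sum_image_bij[OF l(1)] cards by metis
qed

lemma complete_bipartite_verts:
  assumes "complete_bipartite_digraph b c H"
  shows "card (verts H) = b + c"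
proof -
  obtain U V where G: "graph H" "verts H = U \<union> V" "U \<inter> V = {}" "card U = b" "card V = c"
    using assms unfolding complete_bipartite_digraph_def by blast
  interpret graph H by fact
  have "finite U" "finite V" using finite_verts G(2) by auto
  then show ?thesis using G by (simp add: card_Un_disjoint)
qed

lemma sum_ge_run:
  assumes "finite X" "0 \<notin> X"
  shows "\<Sum>(run 0 (card X)) \<le> \<Sum>X"
  using assms
proof (induction X rule: finite_linorder_max_induct)
  case (insert b A)
  have "insert b A \<subseteq> {1..b}" using insert by (auto simp: Suc_le_eq less_imp_le) (metis gr0I)
  then have "card (insert b A) \<le> b" by (metis card_atLeastAtMost card_mono diff_Suc_1 finite_atLeastAtMost)
  moreover have "b \<notin> A" using insert.hyps by blast
  ultimately show ?case
    using insert sum_run_add[of 0 "card A" 1] sum_run_1[of "card A"] by simp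
qed (simp add: run_def)

lemma sum_le_top_run:
  assumes "X \<subseteq> {1..m + a + t}" "card X = a"
  shows "\<Sum>X \<le> \<Sum>(run m a) + t * a"
proof -
  have "\<Sum>X \<le> \<Sum>(run (m + t) a)"
    by (rule up_closed_in_sum_max[of "{1..m + a + t}"]) (use assms in \<open>auto simp: in_run up_closed_in_def\<close>)
  then show ?thesis using sum_run_shift[of m t a] by simp
qed

lemma zeta_run: "zeta (a + 1) (a + k) = \<Sum>(run a k)"
  unfolding zeta_def run_def ..

lemma equal_sum_triple_perm:
  "equal_sum_triple N a b c \<Longrightarrow> equal_sum_triple N b a c"
  "equal_sum_triple N a b c \<Longrightarrow> equal_sum_triple N a c b"
proof -
  assume "equal_sum_triple N a b c"
  then obtain A B C where "A \<union> B \<union> C \<subseteq> {1..N}" "A \<inter> B = {}" "A \<inter> C = {}" "B \<inter> C = {}"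
    and card: "card A = a" "card B = b" "card C = c" and "\<Sum>A = \<Sum>B" "\<Sum>B = \<Sum>C"
    unfolding equal_sum_triple_def by blast
  then have "equal_sum_triple N (card B) (card A) (card C)" "equal_sum_triple N (card A) (card C) (card B)"
    by (intro equal_sum_tripleI[of _ _ _ _ "\<Sum>C"]; auto)+
  then show "equal_sum_triple N b a c" "equal_sum_triple N a c b" unfolding card .
qed

lemma distance_magic_index_tripartite_le:
  assumes G: "complete_tripartite_digraph a b c G" and pos: "0 < a" "0 < b" "0 < c"
    and triple: "equal_sum_triple (a + b + c + t) a b c"
  shows "distance_magic_index G \<le> ereal (real t)"
proof -
  obtain A B C where ABC: "A \<union> B \<union> C \<subseteq> {1..a + b + c + t}" "A \<inter> B = {}" "A \<inter> C = {}" "B \<inter> C = {}"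
    "card A = a" "card B = b" "card C = c" "\<Sum>A = \<Sum>B" "\<Sum>B = \<Sum>C"
    using triple unfolding equal_sum_triple_def by blast
  have "A \<union> B \<union> C \<subseteq> {0<..}" using ABC(1) by auto
  then have "admissible G (A \<union> B \<union> C)"
    unfolding admissible_complete_tripartite_iff[OF G pos] using ABC(2-) by blast
  then show ?thesis
    by (rule distance_magic_index_leI) (use ABC(1) pos complete_tripartite_verts[OF G] in simp_all)
qed

lemma admissible_tripartite_bounds:
  assumes G: "complete_tripartite_digraph a b c G" and pos: "0 < a" "0 < b" "0 < c"
    and S: "admissible G S"
  obtains t s where "Max S = a + b + c + t" "s \<le> \<Sum>(run (b + c) a) + t * a" "\<Sum>(run 0 c) \<le> s"
    "\<Sum>(run 0 (b + c)) \<le> 2 * s" "t = 0 \<longrightarrow> 3 * s = \<Sum>(run 0 (a + b + c))"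
proof -
  obtain A B C where ABC: "S = A \<union> B \<union> C" "S \<subseteq> {0<..}" "A \<inter> B = {}" "A \<inter> C = {}" "B \<inter> C = {}"
     "card A = a" "card B = b" "card C = c" "\<Sum>A = \<Sum>B" "\<Sum>B = \<Sum>C"
    using S unfolding admissible_complete_tripartite_iff[OF G pos] by blast
  have fin: "finite A" "finite B" "finite C" using ABC pos card_ge_0_finite by blast+
  have finS: "finite S" using fin ABC by simp
  have BC: "card (B \<union> C) = b + c" "\<Sum>(B \<union> C) = 2 * \<Sum>A"
    using fin ABC by (simp_all add: card_Un_disjoint sum.union_disjoint)
  have dj: "A \<inter> (B \<union> C) = {}" using ABC by blast
  have SU: "S = A \<union> (B \<union> C)" using ABC(1) by blast
  have cS: "card S = a + b + c" 
    using card_Un_disjoint[OF fin(1) _ dj] fin BC ABC SU by simp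
  have tot: "\<Sum>S = 3 * \<Sum>A" 
    using sum.union_disjoint[OF fin(1) _ dj, of "\<lambda>x. x"] fin BC SU by simp
  have sub: "S \<subseteq> {1..Max S}" using finS ABC(2) by (auto simp: Suc_le_eq)
  have "card S \<le> Max S" using card_mono[OF _ sub] by simp
  then obtain t where t: "Max S = a + b + c + t" using cS le_iff_add by metis
  have "\<Sum>A \<le> \<Sum>(run (b + c) a) + t * a"
  proof (rule sum_le_top_run)
    show "A \<subseteq> {1..b + c + a + t}" using sub t ABC(1) by (simp add: ac_simps)
  qed (fact ABC(6))
  moreover have "\<Sum>(run 0 c) \<le> \<Sum>A"
    using sum_ge_run[of C] fin ABC by auto
  moreover have "\<Sum>(run 0 (b + c)) \<le> 2 * \<Sum>A"
    using sum_ge_run[of "B \<union> C"] fin ABC BC by auto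
  moreover have "t = 0 \<longrightarrow> 3 * \<Sum>A = \<Sum>(run 0 (a + b + c))"
  proof
    assume t0: "t = 0"
    have "S = {1..a + b + c}"
      by (rule card_subset_eq) (use sub t t0 cS in auto)
    then show "3 * \<Sum>A = \<Sum>(run 0 (a + b + c))" using tot unfolding run_def by simp
  qed
  ultimately show thesis by (rule that[OF t])
qed

text \<open>
  If the third sum is too large by 1, one label in each part is raised, by \<open>n + 1\<close> in the first two parts and
  by \<open>n\<close> in the third one. The raised labels are distinct when \<open>x + 1 \<noteq> z\<close> and \<open>y + 1 \<noteq> z\<close>.
\<close>

lemma shifted_labels:
  assumes T: "tripartition {1..n} P Q R" and card2: "2 \<le> card P" "2 \<le> card Q" "2 \<le> card R"
    and sums: "\<Sum>Q = \<Sum>P" "\<Sum>R = \<Sum>P + 1"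
  shows "equal_sum_triple (n + (n + 1)) (card P) (card Q) (card R)"
proof -
  have un: "P \<union> Q \<union> R = {1..n}" and dj: "P \<inter> Q = {}" "P \<inter> R = {}" "Q \<inter> R = {}"
    using T unfolding tripartition_def by blast+
  have fin: "finite P" "finite Q" "finite R" using un by (metis finite_Un finite_atLeastAtMost)+
  have other: "\<exists>z\<in>X. z + 1 \<noteq> w" if "2 \<le> card X" for X :: "nat set" and w
  proof (rule ccontr)
    assume "\<not> ?thesis"
    then have "X \<subseteq> {w - 1}" by auto
    then have "card X \<le> 1" using card_mono[of "{w - 1}" X] by simp
    with that show False by simp
  qed
  obtain z where z: "z \<in> R" using card2(3) by fastforce
  obtain x where x: "x \<in> P" "x + 1 \<noteq> z" using other[OF card2(1)] by blast
  obtain y where y: "y \<in> Q" "y + 1 \<noteq> z" using other[OF card2(2)] by blast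
  have le: "w \<le> n \<and> 1 \<le> w" if "w \<in> P \<or> w \<in> Q \<or> w \<in> R" for w using un that by auto
  have fresh: "w + n + 1 \<notin> P" "w + n + 1 \<notin> Q" "w + n + 1 \<notin> R" for w using le by fastforce+
  have fresh_z: "z + n \<notin> P" "z + n \<notin> Q" "z + n \<notin> R" using le[of z] z le by fastforce+
  have xy: "x \<noteq> y" using x y dj by blast
  let ?P = "P - {x} \<union> {x + n + 1}" and ?Q = "Q - {y} \<union> {y + n + 1}" and ?R = "R - {z} \<union> {z + n}"
  have c: "card ?P = card P" "card ?Q = card Q" "card ?R = card R"
    using exchange(1)[OF fin(1), of "{x}" "{x + n + 1}"] exchange(1)[OF fin(2), of "{y}" "{y + n + 1}"]
      exchange(1)[OF fin(3), of "{z}" "{z + n}"] x y z fresh fresh_z by simp_all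
  have s: "\<Sum>?P = \<Sum>P + (n + 1)" "\<Sum>?Q = \<Sum>Q + (n + 1)" "\<Sum>?R = \<Sum>R + n"
    using exchange(2)[OF fin(1), of "{x}" "{x + n + 1}"] exchange(2)[OF fin(2), of "{y}" "{y + n + 1}"]
      exchange(2)[OF fin(3), of "{z}" "{z + n}"] x y z fresh fresh_z by simp_all
  have "equal_sum_triple (n + (n + 1)) (card ?P) (card ?Q) (card ?R)"
  proof (rule equal_sum_tripleI)
    have "P - {x} \<subseteq> {1..n + (n + 1)}" "Q - {y} \<subseteq> {1..n + (n + 1)}" "R - {z} \<subseteq> {1..n + (n + 1)}"
      using le by fastforce+
    then show "?P \<union> ?Q \<union> ?R \<subseteq> {1..n + (n + 1)}"
      using le[of x] le[of y] le[of z] x y z by simp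
    show "?P \<inter> ?Q = {}" using dj fresh xy by auto
    show "?P \<inter> ?R = {}" using dj fresh fresh_z x(2) by auto
    show "?Q \<inter> ?R = {}" using dj fresh fresh_z y(2) by auto
  qed (use s sums in simp_all)
  then show ?thesis unfolding c .
qed

lemma near_equal_cases:
  fixes p q r :: nat
  assumes "p \<le> q + 1" "p \<le> r + 1" "q \<le> p + 1" "q \<le> r + 1" "r \<le> p + 1" "r \<le> q + 1"
  shows "(p + q + r) mod 3 = 0 \<Longrightarrow> p = q \<and> q = r"
    "(p + q + r) mod 3 = 1 \<Longrightarrow> p = q \<and> r = p + 1 \<or> p = r \<and> q = p + 1 \<or> q = r \<and> p = q + 1"
proof -
  have bound: "x \<le> k + d" "k \<le> x" if "x \<le> y + 1" "x \<le> z + 1" "y \<le> x + 1" "z \<le> x + 1" "x + y + z = 3 * k + d" "d \<le> 1"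
    for x y z k d :: nat
    using that by linarith+
  define k where "k = (p + q + r) div 3"
  show "p = q \<and> q = r" if "(p + q + r) mod 3 = 0"
  proof -
    have k: "p + q + r = 3 * k + 0" using that unfolding k_def by presburger
    show ?thesis
      using bound[of p q r k 0] bound[of q p r k 0] bound[of r p q k 0] assms k by linarith
  qed
  show "p = q \<and> r = p + 1 \<or> p = r \<and> q = p + 1 \<or> q = r \<and> p = q + 1" if "(p + q + r) mod 3 = 1"
  proof -
    have k: "p + q + r = 3 * k + 1" using that unfolding k_def by presburger
    have "p = k \<or> p = k + 1" "q = k \<or> q = k + 1" "r = k \<or> r = k + 1"
      using bound[of p q r k 1] bound[of q p r k 1] bound[of r p q k 1] assms k by linarith+
    then show ?thesis using k by auto
  qed
qed

text \<open>The two residues of the total modulo 3 correspond to the index 0 and to the range from 1 to \<open>n + 1\<close>.\<close>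

lemma near_equal_sum_triples:
  assumes sz: "2 \<le> a" "a \<le> b" "b \<le> c" and G: "complete_tripartite_digraph a b c G"
    and top: "\<Sum>{1..a + b + c} \<le> 3 * \<Sum>{b + c + 1..a + b + c}" and low: "3 * \<Sum>{1..c} \<le> \<Sum>{1..a + b + c}"
  shows "\<Sum>{1..a + b + c} mod 3 = 0 \<Longrightarrow> equal_sum_triple (a + b + c) a b c"
    "\<Sum>{1..a + b + c} mod 3 = 1 \<Longrightarrow> equal_sum_triple (a + b + c + (a + b + c + 1)) a b c"
proof -
  have top': "\<Sum>{1..a + b + c} \<le> 3 * \<Sum>{a + b + c - a + 1..a + b + c}" using top by simp
  obtain A B C where T: "tripartition {1..a + b + c} A B C" and card: "card A = a" "card B = b" "card C = c"
    and near: "\<forall>X\<in>{A,B,C}. \<forall>Y\<in>{A,B,C}. \<Sum>X \<le> \<Sum>Y + 1"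
    by (rule near_equal_tripartition[OF sz refl top' low])
  have un: "A \<union> B \<union> C = {1..a + b + c}" and dj: "A \<inter> B = {}" "A \<inter> C = {}" "B \<inter> C = {}" "(A \<union> B) \<inter> C = {}"
    using T unfolding tripartition_def by blast+
  have fin: "finite A" "finite B" "finite C" using un by (metis finite_Un finite_atLeastAtMost)+
  have tot: "\<Sum>{1..a + b + c} = \<Sum>A + \<Sum>B + \<Sum>C"
    unfolding un[symmetric] using fin dj by (simp add: sum.union_disjoint)
  have near': "\<Sum>A \<le> \<Sum>B + 1" "\<Sum>A \<le> \<Sum>C + 1" "\<Sum>B \<le> \<Sum>A + 1" "\<Sum>B \<le> \<Sum>C + 1"
    "\<Sum>C \<le> \<Sum>A + 1" "\<Sum>C \<le> \<Sum>B + 1"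
    using near by blast+
  note cases = near_equal_cases[OF near']
  show "equal_sum_triple (a + b + c) a b c" if "\<Sum>{1..a + b + c} mod 3 = 0"
  proof -
    have eq: "\<Sum>A = \<Sum>B \<and> \<Sum>B = \<Sum>C" using cases(1) that unfolding tot .
    have "equal_sum_triple (a + b + c) (card A) (card B) (card C)"
      by (rule equal_sum_tripleI[OF equalityD1[OF un] dj(1-3), of "\<Sum>A"]) (use eq in simp_all)
    then show ?thesis unfolding card .
  qed
  show "equal_sum_triple (a + b + c + (a + b + c + 1)) a b c" if "\<Sum>{1..a + b + c} mod 3 = 1"
  proof -
    have "\<Sum>A = \<Sum>B \<and> \<Sum>C = \<Sum>A + 1 \<or> \<Sum>A = \<Sum>C \<and> \<Sum>B = \<Sum>A + 1 \<or> \<Sum>B = \<Sum>C \<and> \<Sum>A = \<Sum>B + 1"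
      using cases(2) that unfolding tot .
    then consider "\<Sum>A = \<Sum>B" "\<Sum>C = \<Sum>A + 1" | "\<Sum>A = \<Sum>C" "\<Sum>B = \<Sum>A + 1" | "\<Sum>B = \<Sum>C" "\<Sum>A = \<Sum>B + 1" by blast
    then show ?thesis
    proof cases
      case 1
      then show ?thesis using shifted_labels[OF T] card sz by simp
    next
      case 2
      then have "equal_sum_triple (a + b + c + (a + b + c + 1)) a c b"
        using shifted_labels[OF tripartition_perm(2)[OF T]] card sz by simp
      then show ?thesis by (rule equal_sum_triple_perm(2))
    next
      case 3
      then have "equal_sum_triple (a + b + c + (a + b + c + 1)) b c a"
        using shifted_labels[OF tripartition_perm(2)[OF tripartition_perm(1)[OF T]]] card sz by simp
      then show ?thesis using equal_sum_triple_perm by blast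
    qed
  qed
qed

lemma even_sum_run:
  "even (\<Sum>(run 0 m)) \<longleftrightarrow> m mod 4 = 0 \<or> m mod 4 = 3"
proof (induction m rule: nat_less_induct)
  case (1 m)
  show ?case
  proof (cases "m < 4")
    case True
    then have "m \<in> {0,1,2,3}" by auto
    then show ?thesis using sum_run[of 0 m] by (auto simp: run_def) 
  next
    case False
    then obtain k where m: "m = k + 4" by (metis add.commute le_iff_add not_less)
    have "\<Sum>(run 0 m) = \<Sum>(run 0 k) + (4 * k + 10)"
      using sum_run_add[of 0 k 4] sum_run[of k 4] m by simp
    then show ?thesis using 1 m by simp
  qed
qed

section \<open>The distance magic index of complete tripartite graphs\<close>

theorem theorem2p2:
  fixes G :: "('a, 'b) pre_digraph" and H :: "('c, 'd) pre_digraph"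
    and n1 n2 n3 n :: nat
  assumes "2 \<le> n1" and "n1 \<le> n2" and "n2 \<le> n3"
    and "n = n1 + n2 + n3"
    and "complete_tripartite_digraph n1 n2 n3 G"
  shows
    "(3 * zeta (n - n1 + 1) n \<ge> zeta 1 n \<and> zeta 1 n \<ge> 3 * zeta 1 n3 \<and>
        [2 * zeta 1 n = 0] (mod 6) \<longrightarrow>
      distance_magic_index G = 0)
     \<and>
     (zeta 1 n > 3 * zeta (n - n1 + 1) n \<and> zeta 1 n \<ge> 3 * zeta 1 n3 \<longrightarrow>
      ([n - n1 = 0] (mod 4) \<or> [n - n1 = 3] (mod 4) \<longrightarrow>
         distance_magic_index G = ereal (real_of_int
           \<lceil>(3 * real (zeta 1 (n - n1)) - 2 * real (zeta 1 n)) / (2 * real n1)\<rceil>)) \<and>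
      ([n - n1 = 1] (mod 4) \<or> [n - n1 = 2] (mod 4) \<longrightarrow>
         distance_magic_index G = ereal (real_of_int
           \<lceil>(3 * real (zeta 1 (n - n1)) - 2 * real (zeta 1 n) + 1) / (2 * real n1)\<rceil>)))
     \<and>
     (3 * zeta (n - n1 + 1) n < zeta 1 n \<and> zeta 1 n < 3 * zeta 1 n3 \<longrightarrow>
      distance_magic_index G \<ge> ereal (real_of_int
        \<lceil>(real (zeta 1 n3) - real (zeta (n - n1 + 1) n)) / real (n - n3)\<rceil>))
     \<and>
     (3 * zeta (n - n1 + 1) n \<ge> zeta 1 n \<and> zeta 1 n \<ge> 3 * zeta 1 n3 \<and>
        [2 * zeta 1 n = 2] (mod 6) \<longrightarrow>
      1 \<le> distance_magic_index G \<and> distance_magic_index G \<le> ereal (real (n + 1)))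
     \<and>
     (zeta 1 n \<le> 3 * zeta (n - n1 + 1) n \<and> zeta 1 n < 3 * zeta 1 n3 \<and>
        complete_bipartite_digraph n2 n3 H \<longrightarrow>
      (ereal ((real (zeta 1 n3) - real (zeta (n - n1 + 1) n)) / real n1)
           \<ge> distance_magic_index H \<longrightarrow>
         distance_magic_index G = ereal (real_of_int
           \<lceil>(real (zeta 1 n3) - real (zeta (n - n1 + 1) n)) / real n1\<rceil>)) \<and>
      (ereal ((real (zeta 1 n3) - real (zeta (n - n1 + 1) n)) / real n1)
           < distance_magic_index H \<longrightarrow>
         distance_magic_index G \<le> distance_magic_index H + 1))"
proof -
  note sz = assms(1-3) and n = assms(4) and G = assms(5)
  define m where "m = n2 + n3"
  have pos: "0 < n1" "0 < n2" "0 < n3" using sz by auto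
  have nm: "n - n1 = m" "n = m + n1" "n - n3 = n1 + n2" using n m_def by auto
  define Z Zm T C0 B0 where "Z = \<Sum>(run 0 n)" and "Zm = \<Sum>(run 0 m)" and "T = \<Sum>(run m n1)"
    and "C0 = \<Sum>(run 0 n3)" and "B0 = \<Sum>(run n3 n2)"
  note defs = Z_def Zm_def T_def C0_def B0_def
  have z: "zeta 1 n = Z" "zeta 1 m = Zm" "zeta (m + 1) n = T" "zeta 1 n3 = C0"
    using zeta_run[of 0 n] zeta_run[of 0 m] zeta_run[of m n1] zeta_run[of 0 n3] nm unfolding defs by simp_all
  have Z_Zm: "Z = Zm + T" using sum_run_add[of 0 m n1] nm unfolding defs by simp
  have Zm_B: "Zm = C0 + B0" using sum_run_add[of 0 n3 n2] m_def unfolding defs by (simp add: add.commute)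
  have tail: "\<Sum>(run n3 (n2 + n1)) = B0 + T"
    using sum_run_add[of n3 n2 n1] m_def unfolding defs by (simp add: add.commute)
  have vG: "card (verts G) = n" using complete_tripartite_verts[OF G] n by simp
  have leI: "distance_magic_index G \<le> ereal (real t)" if "equal_sum_triple (n + t) n1 n2 n3" for t
    using distance_magic_index_tripartite_le[OF G pos] that n by simp
  have geI: "ereal x \<le> distance_magic_index G"
    if "\<And>t s. s \<le> T + t * n1 \<Longrightarrow> C0 \<le> s \<Longrightarrow> Zm \<le> 2 * s \<Longrightarrow> (t = 0 \<longrightarrow> 3 * s = Z) \<Longrightarrow> x \<le> real t" for x
  proof (rule distance_magic_index_geI)
    fix S assume "admissible G S"
    then obtain t s where "Max S = n1 + n2 + n3 + t" "s \<le> T + t * n1" "C0 \<le> s" "Zm \<le> 2 * s" "t = 0 \<longrightarrow> 3 * s = Z"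
      unfolding defs m_def n by (rule admissible_tripartite_bounds[OF G pos])
    then show "x + real (card (verts G)) \<le> real (Max S)"
      using that[of s t] vG n by simp
  qed
  have runs: "{1..n} = run 0 n" "{m + 1..n} = run m n1" "{1..n3} = run 0 n3"
    unfolding run_def using nm by simp_all
  have nonneg: "0 \<le> distance_magic_index G" using geI[of 0] by (simp add: zero_ereal_def)
  have part1: "distance_magic_index G = 0" if "Z \<le> 3 * T" "3 * C0 \<le> Z" "[2 * Z = 0] (mod 6)"
  proof -
    have "Z mod 3 = 0" using that(3) unfolding cong_def by presburger
    then have "equal_sum_triple n n1 n2 n3"
      using near_equal_sum_triples(1)[OF sz G] that(1,2) runs unfolding defs n m_def by simp
    then show ?thesis using leI[of 0] nonneg by (simp add: zero_ereal_def)
  qed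
  have part4: "1 \<le> distance_magic_index G \<and> distance_magic_index G \<le> ereal (real (n + 1))"
    if "Z \<le> 3 * T" "3 * C0 \<le> Z" "[2 * Z = 2] (mod 6)"
  proof
    have Z1: "Z mod 3 = 1" using that(3) unfolding cong_def by presburger
    then have "equal_sum_triple (n + (n + 1)) n1 n2 n3"
      using near_equal_sum_triples(2)[OF sz G] that(1,2) runs unfolding defs n m_def by simp
    then show "distance_magic_index G \<le> ereal (real (n + 1))" by (rule leI)
    have "ereal 1 \<le> distance_magic_index G"
    proof (rule geI)
      fix t s :: nat assume "t = 0 \<longrightarrow> 3 * s = Z"
      with Z1 have "t \<noteq> 0" by (metis One_nat_def mod_mult_self1_is_0 zero_neq_one)
      then show "1 \<le> real t" by simp
    qed
    then show "1 \<le> distance_magic_index G" by (simp add: one_ereal_def)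
  qed
  have part2: "distance_magic_index G = ereal (real_of_int \<lceil>(3 * real Zm - 2 * real Z + \<delta>) / (2 * real n1)\<rceil>)"
    if "3 * T < Z" "3 * C0 \<le> Z" "(\<delta> = 0) \<or> (\<delta> = 1 \<and> odd Zm)" for \<delta> :: real
  proof (rule antisym)
    let ?y = "(3 * real Zm - 2 * real Z + \<delta>) / (2 * real n1)"
    have num: "3 * real Zm - 2 * real Z = real Zm - 2 * real T" using Z_Zm by simp
    have "0 \<le> ?y" using that num Z_Zm by (intro divide_nonneg_nonneg) auto
    then have y0: "0 \<le> \<lceil>?y\<rceil>" by linarith
    define t where "t = nat \<lceil>?y\<rceil>"
    have t: "real t = real_of_int \<lceil>?y\<rceil>" using y0 t_def by simp
    have "?y \<le> real t" unfolding t by simp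
    then have "3 * real Zm - 2 * real Z + \<delta> \<le> real t * (2 * real n1)"
      using pos by (simp add: divide_le_eq)
    then have "real Zm \<le> real (2 * (T + t * n1))" using num that(3) by auto
    then have "Zm \<le> 2 * (T + t * n1)" by linarith
    moreover have "2 * T < Zm" "2 * C0 \<le> Zm" using that(1,2) Z_Zm by linarith+
    ultimately have "equal_sum_triple (n + t) n1 n2 n3"
      using equal_sum_triple_large_top[OF sz m_def, of t] nm unfolding defs by simp
    from leI[OF this] show "distance_magic_index G \<le> ereal (real_of_int \<lceil>?y\<rceil>)" unfolding t .
    show "ereal (real_of_int \<lceil>?y\<rceil>) \<le> distance_magic_index G"
    proof (rule geI)
      fix t s :: nat assume s: "s \<le> T + t * n1" "Zm \<le> 2 * s"
      have base: "Zm \<le> 2 * (T + t * n1)"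
        using order_trans[OF s(2) mult_le_mono2[OF s(1)]] .
      have "real Zm + \<delta> \<le> real (2 * (T + t * n1))"
      proof (cases "odd Zm")
        case True
        then have "Zm \<noteq> 2 * (T + t * n1)" by auto
        with base have "Zm + 1 \<le> 2 * (T + t * n1)" by simp
        then have "real (Zm + 1) \<le> real (2 * (T + t * n1))" by (rule of_nat_mono)
        then show ?thesis using that(3) by auto
      next
        case False
        then have "\<delta> = 0" using that(3) by blast
        moreover have "real Zm \<le> real (2 * (T + t * n1))" using base by (rule of_nat_mono)
        ultimately show ?thesis by simp
      qed
      then have "3 * real Zm - 2 * real Z + \<delta> \<le> real t * (2 * real n1)"
        using num by (simp add: algebra_simps)
      then have "?y \<le> real t" using pos by (simp add: divide_le_eq)
      then have "\<lceil>?y\<rceil> \<le> int t" by (simp add: ceiling_le_iff)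
      then show "real_of_int \<lceil>?y\<rceil> \<le> real t" by linarith
    qed
  qed
  have odd: "odd Zm" if "[m = 1] (mod 4) \<or> [m = 2] (mod 4)"
    using that even_sum_run[of m] unfolding cong_def Zm_def by auto
  have part3: "ereal (real_of_int \<lceil>(real C0 - real T) / real (n1 + n2)\<rceil>) \<le> distance_magic_index G"
  proof (rule geI)
    fix t s :: nat assume "s \<le> T + t * n1" "C0 \<le> s"
    then have "C0 \<le> T + t * n1" by linarith
    also have "\<dots> \<le> T + t * (n1 + n2)" by simp
    finally have "real C0 \<le> real (T + t * (n1 + n2))" by (rule of_nat_mono)
    then have "(real C0 - real T) / real (n1 + n2) \<le> real t"
      using pos by (simp add: divide_le_eq)
    then have "\<lceil>(real C0 - real T) / real (n1 + n2)\<rceil> \<le> int t" by (simp add: ceiling_le_iff)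
    then show "real_of_int \<lceil>(real C0 - real T) / real (n1 + n2)\<rceil> \<le> real t" by linarith
  qed
  have part5: "\<not> distance_magic_index H \<le> ereal ((real C0 - real T) / real n1)"
      "distance_magic_index G \<le> distance_magic_index H + 1"
    if top: "Z \<le> 3 * T" and low: "Z < 3 * C0" and H: "complete_bipartite_digraph n2 n3 H"
  proof -
    have vH: "card (verts H) = m" using complete_bipartite_verts[OF H] m_def by simp
    have arith: "Zm \<le> 2 * T" "B0 + T < 2 * C0" "B0 < C0"
      using top low Z_Zm Zm_B by linarith+
    have b2a: "n2 < 2 * n1"
      using parts_comparable[OF sz m_def] arith tail unfolding defs by simp
    have "\<not> distance_magic_index H \<le> ereal ((real C0 - real T) / real n1) \<and>
      distance_magic_index G \<le> distance_magic_index H + 1"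
    proof (rule distance_magic_index_cases[of H])
      show "0 < card (verts H)" using vH m_def pos by simp
    next
      assume "distance_magic_index H = \<infinity>"
      then show ?thesis by simp
    next
      fix S h
      assume S: "admissible H S" "S \<subseteq> {1..card (verts H) + h}" and h: "distance_magic_index H = ereal (real h)"
      obtain B C where BC: "S = B \<union> C" "B \<inter> C = {}" "card B = n2" "card C = n3" "\<Sum>B = \<Sum>C"
        by (rule admissible_complete_bipartite_parts[OF H pos(2,3) S(1)])
      have C: "finite C" "0 \<notin> C"
        using BC(4) pos(3) card_ge_0_finite[of C] subsetD[OF S(2), of 0] BC(1) by auto
      have "C0 \<le> \<Sum>C"
        using sum_ge_run[OF C] BC(4) unfolding C0_def by simp
      also have "\<Sum>C \<le> B0 + h * n2"
        using sum_le_top_run[of B n3 n2 h] BC(1,3,5) S(2) vH unfolding B0_def m_def by (simp add: add.commute)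
      finally have hb: "C0 \<le> B0 + h * n2" .
      have "equal_sum_triple (n + (h + 1)) n1 n2 n3"
        using equal_sum_triple_small_low[OF sz m_def] arith tail hb nm unfolding defs by simp
      from leI[OF this] have "distance_magic_index G \<le> distance_magic_index H + 1"
        unfolding h by (simp add: one_ereal_def add.commute)
      \<comment> \<open>With \<open>top\<close>, a shift by \<open>h\<close> that brings the \<open>n2\<close> labels after \<open>n3\<close> up to the sum \<open>C0\<close> more than suffices
        to bring the top \<open>n1\<close> labels up to it. So the first alternative for \<open>H\<close> never occurs.\<close>
      moreover have "\<not> real h \<le> (real C0 - real T) / real n1"
      proof
        assume "real h \<le> (real C0 - real T) / real n1"
        then have "real h * real n1 \<le> real C0 - real T" using pos by (simp add: le_divide_eq)
        then have "real (h * n1 + T) \<le> real C0" by simp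
        then have le: "h * n1 + T \<le> C0" by linarith
        have "h \<noteq> 0" using hb arith(3) by (cases "h = 0") auto
        then have "h * n2 < h * (2 * n1)" using b2a by simp
        also have "\<dots> = 2 * (h * n1)" by simp
        finally show False using le hb arith(1) Zm_B by linarith
      qed
      ultimately show ?thesis unfolding h by simp
    qed
    then show "\<not> distance_magic_index H \<le> ereal ((real C0 - real T) / real n1)"
      "distance_magic_index G \<le> distance_magic_index H + 1" by blast+
  qed
  have part2a: "distance_magic_index G = ereal (real_of_int \<lceil>(3 * real Zm - 2 * real Z) / (2 * real n1)\<rceil>)"
    if "3 * T < Z" "3 * C0 \<le> Z"
    using part2[of 0] that by simp
  have part2b: "distance_magic_index G = ereal (real_of_int \<lceil>(3 * real Zm - 2 * real Z + 1) / (2 * real n1)\<rceil>)"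
    if "3 * T < Z" "3 * C0 \<le> Z" "[m = 1] (mod 4) \<or> [m = 2] (mod 4)"
    using part2[of 1] that odd by simp
  show ?thesis
    unfolding nm(1,3) z
    using part1 part4 part2a part2b part3 part5 by blast
qed

end
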